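(* Let $A\in\mathbb{R}^{m\times n}$ be semi-monotone, let $A=P_1-R_1+S_1$ be a double proper weak regular splitting and $A=P_2-R_2+S_2$ a double proper regular splitting of $A$. Suppose $N(S_2)\supseteq N(P_2)$, $R(S_2)\subseteq R(P_2)$, $1\notin\sigma(S_2P_1^{\dagger})$, $\widehat{A}^{\dagger}\geq 0$ where $\widehat{A}=(I-S_2P_1^{\dagger})A$, $P_1^{\dagger}R_1\geq P_2^{\dagger}R_2$ and $P_2^{\dagger}S_2\geq P_1^{\dagger}S_1$. Then $\rho(W_{12})\leq\min\{\rho(T_1),\rho(T_2)\}<1$, where $$W_{12}=\begin{pmatrix} P_2^{\dagger}R_2-P_2^{\dagger}S_2P_1^{\dagger}R_1 & P_2^{\dagger}S_2P_1^{\dagger}S_1\\ I & 0\end{pmatrix},\qquad T_i=\begin{pmatrix} P_i^{\dagger}R_i & -P_i^{\dagger}S_i\\ I&0\end{pmatrix}\ (i=1,2).$$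
   Context: For $M\in\mathbb{R}^{m\times n}$, $M^{\dagger}$ is its Moore–Penrose inverse, $R(M)$, $N(M)$ its range and null space; inequalities are entrywise; $\rho$ is the spectral radius, $\sigma$ the spectrum. $A$ is semi-monotone if $A^{\dagger}\geq 0$. A double splitting $A=P-R+S$ is a double proper splitting if $R(P)=R(A)$ and $N(P)=N(A)$; it is double proper regular if moreover $P^{\dagger}\geq0$, $R\geq0$, $S\leq0$; double proper weak regular if moreover $P^{\dagger}\geq 0$, $P^{\dagger}R\geq 0$, $P^{\dagger}S\leq 0$. *)

theory Defs
  imports "Jordan_Normal_Form.Spectral_Radius"
begin

definition mp_inverse :: "real mat \<Rightarrow> real mat" ("_\<^sup>\<dagger>" [1000] 1000) where
  "mp_inverse M = (THE X. X \<in> carrier_mat (dim_col M) (dim_row M) \<and>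
      M * X * M = M \<and> X * M * X = X \<and>
      transpose_mat (M * X) = M * X \<and> transpose_mat (X * M) = X * M)"

definition range_space :: "real mat \<Rightarrow> real vec set" where
  "range_space M = {M *\<^sub>v x | x. x \<in> carrier_vec (dim_col M)}"

definition null_space :: "real mat \<Rightarrow> real vec set" where
  "null_space M = {x \<in> carrier_vec (dim_col M). M *\<^sub>v x = 0\<^sub>v (dim_row M)}"

definition mat_ge :: "real mat \<Rightarrow> real mat \<Rightarrow> bool" where
  "mat_ge M N = (dim_row M = dim_row N \<and> dim_col M = dim_col N \<and>
     (\<forall>i<dim_row M. \<forall>j<dim_col M. M $$ (i,j) \<ge> N $$ (i,j)))"

definition nonneg_mat :: "real mat \<Rightarrow> bool" where
  "nonneg_mat M = (\<forall>i<dim_row M. \<forall>j<dim_col M. M $$ (i,j) \<ge> 0)"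

definition nonpos_mat :: "real mat \<Rightarrow> bool" where
  "nonpos_mat M = (\<forall>i<dim_row M. \<forall>j<dim_col M. M $$ (i,j) \<le> 0)"

definition semi_monotone :: "real mat \<Rightarrow> bool" where
  "semi_monotone A = nonneg_mat (A\<^sup>\<dagger>)"

definition double_proper_splitting :: "real mat \<Rightarrow> real mat \<Rightarrow> real mat \<Rightarrow> real mat \<Rightarrow> bool" where
  "double_proper_splitting A P R S =
     (P \<in> carrier_mat (dim_row A) (dim_col A) \<and> R \<in> carrier_mat (dim_row A) (dim_col A) \<and>
      S \<in> carrier_mat (dim_row A) (dim_col A) \<and> A = P - R + S \<and>
      range_space P = range_space A \<and> null_space P = null_space A)"

definition double_proper_regular_splitting :: "real mat \<Rightarrow> real mat \<Rightarrow> real mat \<Rightarrow> real mat \<Rightarrow> bool" where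
  "double_proper_regular_splitting A P R S =
     (double_proper_splitting A P R S \<and> nonneg_mat (P\<^sup>\<dagger>) \<and> nonneg_mat R \<and> nonpos_mat S)"

definition double_proper_weak_regular_splitting :: "real mat \<Rightarrow> real mat \<Rightarrow> real mat \<Rightarrow> real mat \<Rightarrow> bool" where
  "double_proper_weak_regular_splitting A P R S =
     (double_proper_splitting A P R S \<and> nonneg_mat (P\<^sup>\<dagger>) \<and>
      nonneg_mat (P\<^sup>\<dagger> * R) \<and> nonpos_mat (P\<^sup>\<dagger> * S))"

(* spectrum and spectral radius of a real square matrix, taken over the complex numbers *)
definition cplx :: "real mat \<Rightarrow> complex mat" where
  "cplx M = map_mat complex_of_real M"

definition iter_mat :: "real mat \<Rightarrow> real mat \<Rightarrow> real mat \<Rightarrow> real mat" where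
  "iter_mat P R S = four_block_mat (P\<^sup>\<dagger> * R) (- (P\<^sup>\<dagger> * S)) (1\<^sub>m (dim_col P)) (0\<^sub>m (dim_col P) (dim_col P))"

end

theory Submission
  imports Defs
begin

text \<open>
  Write $B_i = P_i^\dagger R_i$, $C_i = -P_i^\dagger S_i$ and $U = R_2 - S_2 \ge 0$, so that all
  blocks of $T_1$, $T_2$, $W_{12}$ are nonnegative and $0 \le T_2 \le T_1$; hence the minimum is
  $\rho(T_2)$.  A nonnegative block companion matrix with blocks $X, Y$ has spectral radius at most
  $s$ as soon as some $x \ge 0$ satisfies $s X x + Y x \le s^2 x$ and the rows of $X, Y$ vanish
  where $x$ does.

  With $g = U (1,\dots,1)^T$, the vector $x = A^\dagger g$ satisfies
  $(B_2 + C_2) x = x - P_2^\dagger g$ and is bounded by a multiple of $P_2^\dagger g$, which gives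
  $\rho(T_2) < 1$.  For $\rho(T_2) < s < 1$ let $x \ge 0$ solve
  $s^2 x = s B_2 x + C_2 x + P_2^\dagger g$.  Multiplying by $P_2$ and using $R_2 \ge 0 \ge S_2$
  yields $A x \ge 0$, whence $x - B_1 x - C_1 x = P_1^\dagger A x \ge 0$.  Replacing $C_2 x$ by the
  smaller $C_2 (s B_1 x + C_1 x)$ turns the equation for $x$ into the inequality that bounds
  $\rho(W_{12})$ by $s$.
\<close>

section \<open>Spectral radius of nonnegative matrices\<close>

lemma mult_mat_vec_entry:
  "i < dim_row M \<Longrightarrow> dim_col M = dim_vec x \<Longrightarrow> (M *\<^sub>v x) $ i = (\<Sum>j<dim_vec x. M $$ (i,j) * x $ j)"
  by (auto simp: scalar_prod_def atLeast0LessThan intro!: sum.cong)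

lemma nonneg_mat_entry: "nonneg_mat M \<Longrightarrow> i < dim_row M \<Longrightarrow> j < dim_col M \<Longrightarrow> 0 \<le> M $$ (i,j)"
  by (simp add: nonneg_mat_def)

lemma mult_mat_vec_mono:
  assumes "nonneg_mat M" "u \<le> v" "dim_col M = dim_vec v"
  shows "M *\<^sub>v u \<le> M *\<^sub>v v"
proof -
  have d: "dim_vec u = dim_vec v" and le: "\<And>j. j < dim_vec v \<Longrightarrow> u $ j \<le> v $ j"
    using assms(2) by (auto simp: less_eq_vec_def)
  have "(M *\<^sub>v u) $ i \<le> (M *\<^sub>v v) $ i" if "i < dim_row M" for i
    using that assms d le
    by (auto simp: mult_mat_vec_entry simp del: index_mult_mat_vec
        intro!: sum_mono mult_left_mono nonneg_mat_entry)
  then show ?thesis by (simp add: less_eq_vec_def del: index_mult_mat_vec)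
qed

lemma mult_mat_vec_nonneg:
  assumes "nonneg_mat M" "0\<^sub>v n \<le> v" "dim_col M = n" "dim_row M = m"
  shows "0\<^sub>v m \<le> M *\<^sub>v v"
proof -
  have "dim_vec v = n" using assms(2) by (simp add: less_eq_vec_def)
  moreover have "M *\<^sub>v 0\<^sub>v n = 0\<^sub>v m" using assms(3,4) by (intro eq_vecI) auto
  ultimately show ?thesis using mult_mat_vec_mono[OF assms(1,2)] assms(3) by simp
qed

lemma cplx_carrier [simp]: "cplx M \<in> carrier_mat m n \<longleftrightarrow> M \<in> carrier_mat m n"
  by (simp add: cplx_def)

section \<open>Eigenvalues, subinvariant vectors and the resolvent\<close>

lemma eigenvalue_le_spectral_radius:
  assumes "A \<in> carrier_mat n n" "eigenvalue A k"
  shows "norm k \<le> spectral_radius A"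
  using assms spectral_radius_mem_max(2)[OF assms(1) eigenvalue_imp_nonzero_dim[OF assms]]
  by (auto simp: spectrum_def)

lemma spectral_radius_leI:
  assumes "A \<in> carrier_mat n n" "n > 0" "\<And>k. eigenvalue A k \<Longrightarrow> norm k \<le> r"
  shows "spectral_radius A \<le> r"
  using spectral_radius_mem_max(1)[OF assms(1,2)] assms(3) by (auto simp: spectrum_def)

lemma spectral_radius_nonneg:
  assumes "A \<in> carrier_mat n n" "n > 0"
  shows "0 \<le> spectral_radius A"
  using spectral_radius_mem_max(1)[OF assms] by auto

lemma eigenvalue_smult:
  assumes "A \<in> carrier_mat n n" "eigenvalue (a \<cdot>\<^sub>m A) k" "a \<noteq> (0::'a::field)"
  shows "eigenvalue A (k / a)"
proof -
  obtain v where v: "v \<in> carrier_vec n" "v \<noteq> 0\<^sub>v n" "(a \<cdot>\<^sub>m A) *\<^sub>v v = k \<cdot>\<^sub>v v"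
    using assms(1,2) by (auto simp: eigenvalue_def eigenvector_def)
  have "A *\<^sub>v v = (k / a) \<cdot>\<^sub>v v"
  proof (rule eq_vecI)
    fix i assume "i < dim_vec ((k / a) \<cdot>\<^sub>v v)"
    then have i: "i < n" using v(1) by auto
    have "((a \<cdot>\<^sub>m A) *\<^sub>v v) $ i = (k \<cdot>\<^sub>v v) $ i" using v(3) by simp
    then show "(A *\<^sub>v v) $ i = ((k / a) \<cdot>\<^sub>v v) $ i"
      using i v(1) assms(1,3) by (simp add: field_simps)
  qed (use assms v in auto)
  then show ?thesis using v assms(1) by (auto simp: eigenvalue_def eigenvector_def)
qed

text \<open>If $\rho(T) < q < s$, the powers of $T/q$ are bounded although
  $(T/q)^k w \ge (s/q)^k w$.\<close>

lemma subinvariant_le_spectral_radius: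
  assumes T: "T \<in> carrier_mat n n" and T0: "nonneg_mat T"
    and w0: "0\<^sub>v n \<le> w" and wne: "w \<noteq> 0\<^sub>v n" and le: "s \<cdot>\<^sub>v w \<le> T *\<^sub>v w"
  shows "s \<le> spectral_radius (cplx T)"
proof (rule ccontr)
  define r where "r = spectral_radius (cplx T)"
  assume "\<not> s \<le> spectral_radius (cplx T)"
  then obtain q where q: "r < q" "q < s" unfolding r_def by (meson dense not_le)
  have w: "w \<in> carrier_vec n" using w0 by (auto simp: less_eq_vec_def)
  obtain i where i: "i < n" "w $ i \<noteq> 0" using wne w by (metis carrier_vecD eq_vecI index_zero_vec)
  then have wi: "w $ i > 0" using w0 w by (auto simp: less_eq_vec_def order.strict_iff_order)
  have "0 \<le> r" unfolding r_def using i T by (intro spectral_radius_nonneg[of _ n]) auto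
  then have q0: "0 < q" using q by simp
  define K where "K = (1 / q) \<cdot>\<^sub>m T"
  have K: "K \<in> carrier_mat n n" and K0: "nonneg_mat K"
    using T T0 q0 by (auto simp: K_def nonneg_mat_def)
  have cK: "cplx K = complex_of_real (1/q) \<cdot>\<^sub>m cplx T"
    by (intro eq_matI) (auto simp: K_def cplx_def)
  have "spectral_radius (cplx K) \<le> r / q"
  proof (rule spectral_radius_leI[of _ n])
    fix k assume "eigenvalue (cplx K) k"
    then have "eigenvalue (cplx T) (k / complex_of_real (1/q))"
      unfolding cK using T q0 by (intro eigenvalue_smult[of _ n]) auto
    then have "norm (k / complex_of_real (1/q)) \<le> r" unfolding r_def
      using T by (intro eigenvalue_le_spectral_radius[of _ n]) auto
    then show "norm k \<le> r / q" using q0 by (simp add: norm_divide norm_mult field_simps)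
  qed (use K i in auto)
  also have "\<dots> < 1" using q q0 by simp
  finally obtain c where c: "\<And>k. norm_bound (cplx K ^\<^sub>m k) c"
    using spectral_radius_jnf_norm_bound_less_1_upper_triangular[of "cplx K" n] K by auto
  have entry: "(K ^\<^sub>m k) $$ (a,b) \<le> c" if "a < n" "b < n" for k a b
  proof -
    have "cplx K ^\<^sub>m k = cplx (K ^\<^sub>m k)" unfolding cplx_def by (rule of_real_hom.mat_hom_pow[OF K, symmetric])
    moreover have "K ^\<^sub>m k \<in> carrier_mat n n" using K by simp
    ultimately have "norm (complex_of_real ((K ^\<^sub>m k) $$ (a,b))) \<le> c"
      using c[of k] that K by (auto simp: norm_bound_def cplx_def)
    then show ?thesis by simp
  qed
  define t where "t = s / q"
  have t: "t > 1" using q q0 by (simp add: t_def)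
  have Kw: "t \<cdot>\<^sub>v w \<le> K *\<^sub>v w"
    using le q0 T w by (auto simp: less_eq_vec_def K_def t_def divide_right_mono)
  have pow: "t ^ k \<cdot>\<^sub>v w \<le> (K ^\<^sub>m k) *\<^sub>v w" for k
  proof (induction k)
    case 0
    then show ?case using K w by simp
  next
    case (Suc k)
    have "t ^ Suc k \<cdot>\<^sub>v w \<le> t ^ k \<cdot>\<^sub>v (K *\<^sub>v w)"
      using Kw K w t by (auto simp: less_eq_vec_def mult.assoc mult.left_commute)
    also have "\<dots> = K *\<^sub>v (t ^ k \<cdot>\<^sub>v w)" using K w by (simp add: mult_mat_vec)
    also have "\<dots> \<le> K *\<^sub>v (K ^\<^sub>m k *\<^sub>v w)"
      using Suc K K0 w by (intro mult_mat_vec_mono) auto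
    also have "\<dots> = K ^\<^sub>m Suc k *\<^sub>v w"
    proof -
      \<comment> \<open>Matrix powers unfold with the new factor on the right, whereas the induction
        step multiplies by \<open>K\<close> on the left.\<close>
      have "K * K ^\<^sub>m k = K ^\<^sub>m k * K" 
        by (induction k)
          (use K in \<open>simp_all flip: assoc_mult_mat[OF K pow_carrier_mat[OF K] K]\<close>)
      then show ?thesis using K w by (simp add: assoc_mult_mat_vec[of _ n n _ n, symmetric])
    qed
    finally show ?case .
  qed
  have "t ^ k * w $ i \<le> c * (\<Sum>j<n. w $ j)" for k
  proof -
    have "t ^ k * w $ i \<le> ((K ^\<^sub>m k) *\<^sub>v w) $ i"
      using pow[of k] i w K by (auto simp: less_eq_vec_def)
    also have "\<dots> = (\<Sum>j<n. (K ^\<^sub>m k) $$ (i,j) * w $ j)"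
      using i w K by (subst mult_mat_vec_entry) auto
    also have "\<dots> \<le> (\<Sum>j<n. c * w $ j)"
      using i entry w0 w by (intro sum_mono mult_right_mono) (auto simp: less_eq_vec_def)
    finally show ?thesis by (simp add: sum_distrib_left)
  qed
  moreover obtain k where "c * (\<Sum>j<n. w $ j) / w $ i < t ^ k"
    using real_arch_pow[OF t] by blast
  ultimately show False using wi by (simp add: field_simps not_less[symmetric])
qed

text \<open>This is the nonnegativity of the inverse of \<open>s I - T\<close> for \<open>s\<close>
  above the spectral radius. Such an \<open>s\<close> is not an eigenvalue, so the equation is
  solvable; the sign of the solution follows by showing that its negative part vanishes.\<close>

lemma nonneg_resolvent:
  assumes T: "T \<in> carrier_mat n n" and T0: "nonneg_mat T"
    and s: "spectral_radius (cplx T) < s" and h: "0\<^sub>v n \<le> h"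
  obtains y where "0\<^sub>v n \<le> y" "s \<cdot>\<^sub>v y = T *\<^sub>v y + h"
proof (cases "n = 0")
  case True
  have "s \<cdot>\<^sub>v 0\<^sub>v 0 = T *\<^sub>v 0\<^sub>v 0 + h"
    using True T h by (intro eq_vecI) (auto simp: less_eq_vec_def)
  then show ?thesis using that[of "0\<^sub>v 0"] True by simp
next
  case False
  then have s0: "s > 0" using spectral_radius_nonneg[of "cplx T" n] T s by auto
  have hc: "h \<in> carrier_vec n" using h by (auto simp: less_eq_vec_def)
  define M where "M = s \<cdot>\<^sub>m 1\<^sub>m n - T"
  have M: "M \<in> carrier_mat n n" using T by (auto simp: M_def)
  have Mv: "M *\<^sub>v v = s \<cdot>\<^sub>v v - T *\<^sub>v v" if "v \<in> carrier_vec n" for v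
  proof -
    have "(s \<cdot>\<^sub>m 1\<^sub>m n) *\<^sub>v v = s \<cdot>\<^sub>v v" using that by (intro eq_vecI) auto
    then show ?thesis using that T by (simp add: M_def minus_mult_distrib_mat_vec[of _ n n])
  qed
  have "det M \<noteq> 0"
  proof
    assume "det M = 0"
    then obtain v where v: "v \<in> carrier_vec n" "v \<noteq> 0\<^sub>v n" "M *\<^sub>v v = 0\<^sub>v n"
      using det_0_iff_vec_prod_zero_field[OF M] by auto
    have "T *\<^sub>v v = s \<cdot>\<^sub>v v"
    proof (rule eq_vecI)
      fix i assume "i < dim_vec (s \<cdot>\<^sub>v v)"
      then have "i < n" using v by simp
      then have "(M *\<^sub>v v) $ i = 0" using v by simp
      then show "(T *\<^sub>v v) $ i = (s \<cdot>\<^sub>v v) $ i" using \<open>i < n\<close> v(1) T unfolding Mv[OF v(1)] by simp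
    qed (use T v in auto)
    then have "eigenvalue T s" using v T by (auto simp: eigenvalue_def eigenvector_def)
    then have "eigenvalue (cplx T) (complex_of_real s)"
      unfolding cplx_def by (rule of_real_hom.eigenvalue_hom[OF T])
    then have "norm (complex_of_real s) \<le> spectral_radius (cplx T)"
      using T by (intro eigenvalue_le_spectral_radius[of _ n]) auto
    then show False using s by simp
  qed
  from det_non_zero_imp_unit[OF M this, of "()"]
  obtain B where B: "B \<in> carrier_mat n n" "M * B = 1\<^sub>m n"
    by (auto simp: Units_def ring_mat_def)
  define y where "y = B *\<^sub>v h"
  have y: "y \<in> carrier_vec n" using B hc by (simp add: y_def)
  have "M *\<^sub>v y = h" using B M hc by (simp add: y_def assoc_mult_mat_vec[of _ n n _ n, symmetric])
  then have ent: "s * y $ i - (T *\<^sub>v y) $ i = h $ i" if "i < n" for i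
    using that y T unfolding Mv[OF y] by auto
  then have eq: "s \<cdot>\<^sub>v y = T *\<^sub>v y + h"
    using y T hc by (intro eq_vecI) (auto simp: algebra_simps)
  \<comment> \<open>The negative part of the solution is subinvariant for a factor above the spectral radius, hence zero.\<close>
  define w where "w = vec n (\<lambda>i. max 0 (- y $ i))"
  have w: "w \<in> carrier_vec n" and w0: "0\<^sub>v n \<le> w" by (auto simp: w_def less_eq_vec_def)
  have Tw0: "0\<^sub>v n \<le> T *\<^sub>v w" using T T0 w0 by (intro mult_mat_vec_nonneg) auto
  have yw: "- w \<le> y" using y by (auto simp: w_def less_eq_vec_def)
  have "T *\<^sub>v (- w) \<le> T *\<^sub>v y" using yw T T0 y by (intro mult_mat_vec_mono) auto
  moreover have "T *\<^sub>v (- w) = - (T *\<^sub>v w)" using T w by (intro eq_vecI) auto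
  ultimately have Ty: "- (T *\<^sub>v w) $ i \<le> (T *\<^sub>v y) $ i" if "i < n" for i
    using that T w by (auto simp: less_eq_vec_def)
  \<comment> \<open>Where \<open>y\<close> is negative, \<open>s w = - s y = - T y - h\<close>,
    which is at most \<open>T w\<close> because \<open>- T w \<le> T y\<close> and
    \<open>h \<ge> 0\<close>. Elsewhere \<open>w\<close> is zero.\<close>
  have "s * w $ i \<le> (T *\<^sub>v w) $ i" if i: "i < n" for i
  proof (cases "y $ i < 0")
    case True
    have "h $ i \<ge> 0" using h i hc by (auto simp: less_eq_vec_def)
    then show ?thesis using ent[OF i] Ty[OF i] True i by (simp add: w_def)
  next
    case False
    then show ?thesis using Tw0 i T by (auto simp: w_def less_eq_vec_def)
  qed
  then have "s \<cdot>\<^sub>v w \<le> T *\<^sub>v w" using w T by (auto simp: less_eq_vec_def)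
  then have wz: "w = 0\<^sub>v n"
    using subinvariant_le_spectral_radius[OF T T0 w0] s by force
  have "0 \<le> y $ i" if "i < n" for i
  proof -
    have "w $ i = 0" using wz that by simp
    then show ?thesis using that by (simp add: w_def)
  qed
  then show ?thesis using that[OF _ eq] y by (auto simp: less_eq_vec_def)
qed

text \<open>Taking moduli in \<open>T v = k v\<close> and applying the triangle inequality to the
  nonnegative \<open>T\<close> makes the entrywise modulus of \<open>v\<close> subinvariant. Complex
  eigenvalues are thereby handled through real nonnegative vectors.\<close>

lemma eigenvalue_abs_subinvariant:
  assumes T: "T \<in> carrier_mat n n" and T0: "nonneg_mat T" and ev: "eigenvalue (cplx T) k"
  obtains w where "0\<^sub>v n \<le> w" "w \<noteq> 0\<^sub>v n" "norm k \<cdot>\<^sub>v w \<le> T *\<^sub>v w"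
proof -
  obtain v where v: "v \<in> carrier_vec n" "v \<noteq> 0\<^sub>v n" "cplx T *\<^sub>v v = k \<cdot>\<^sub>v v"
    using ev T by (auto simp: eigenvalue_def eigenvector_def cplx_def)
  obtain i where i: "i < n" "v $ i \<noteq> 0" using v(1,2) by (metis carrier_vecD eq_vecI index_zero_vec)
  define w where "w = map_vec norm v"
  have w: "w \<in> carrier_vec n" "0\<^sub>v n \<le> w" using v by (auto simp: w_def less_eq_vec_def)
  have "w $ i \<noteq> 0" using i v by (simp add: w_def)
  then have wne: "w \<noteq> 0\<^sub>v n" using i by auto
  have "norm k * w $ a \<le> (T *\<^sub>v w) $ a" if a: "a < n" for a
  proof -
    have "norm k * w $ a = norm ((cplx T *\<^sub>v v) $ a)" 
      unfolding v(3) using a v by (simp add: w_def norm_mult)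
    also have "\<dots> = norm (\<Sum>j<n. complex_of_real (T $$ (a,j)) * v $ j)"
      using a v T by (subst mult_mat_vec_entry) (auto simp: cplx_def)
    also have "\<dots> \<le> (\<Sum>j<n. norm (complex_of_real (T $$ (a,j)) * v $ j))" by (rule norm_sum)
    also have "\<dots> = (\<Sum>j<n. T $$ (a,j) * w $ j)"
      using a v T T0 by (intro sum.cong) (auto simp: norm_mult w_def nonneg_mat_def)
    also have "\<dots> = (T *\<^sub>v w) $ a" using a T w by (subst mult_mat_vec_entry) auto
    finally show ?thesis .
  qed
  then show ?thesis using that[OF w(2) wne] w T by (auto simp: less_eq_vec_def)
qed

text \<open>The modulus of an eigenvector of \<open>S\<close> is subinvariant for \<open>S\<close>,
  hence also for the larger matrix \<open>T\<close>, whose spectral radius then bounds the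
  eigenvalue.\<close>

lemma spectral_radius_mono:
  assumes S: "S \<in> carrier_mat n n" and T: "T \<in> carrier_mat n n" and n: "n > 0"
    and S0: "nonneg_mat S" and le: "mat_ge T S"
  shows "spectral_radius (cplx S) \<le> spectral_radius (cplx T)"
proof (rule spectral_radius_leI[of _ n])
  fix k assume "eigenvalue (cplx S) k"
  then obtain w where w: "0\<^sub>v n \<le> w" "w \<noteq> 0\<^sub>v n" "norm k \<cdot>\<^sub>v w \<le> S *\<^sub>v w"
    using eigenvalue_abs_subinvariant[OF S S0] by blast
  have T0: "nonneg_mat T" using S0 le unfolding nonneg_mat_def mat_ge_def by fastforce
  have wc: "w \<in> carrier_vec n" using w(1) by (auto simp: less_eq_vec_def)
  have "(S *\<^sub>v w) $ i \<le> (T *\<^sub>v w) $ i" if "i < n" for i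
    using that S T wc w(1) le
    by (auto simp: mult_mat_vec_entry mat_ge_def less_eq_vec_def simp del: index_mult_mat_vec
        intro!: sum_mono mult_right_mono)
  then have "S *\<^sub>v w \<le> T *\<^sub>v w" using S T by (auto simp: less_eq_vec_def)
  then show "norm k \<le> spectral_radius (cplx T)"
    using w T T0 by (intro subinvariant_le_spectral_radius[of _ n w]) auto
qed (use S n in auto)

text \<open>A comparison of Collatz-Wielandt type: scale \<open>z\<close> until it just dominates
  \<open>w\<close>, and compare both inequalities at an index of contact. The condition
  \<open>supp\<close> ensures that a multiple of \<open>z\<close> dominates \<open>w\<close>
  although \<open>z\<close> may have zero entries.\<close>

lemma subinvariant_le_superinvariant:
  assumes T: "T \<in> carrier_mat n n" and T0: "nonneg_mat T"
    and z0: "0\<^sub>v n \<le> z" and Tz: "T *\<^sub>v z \<le> s \<cdot>\<^sub>v z"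
    and w0: "0\<^sub>v n \<le> w" and wne: "w \<noteq> 0\<^sub>v n" and Tw: "t \<cdot>\<^sub>v w \<le> T *\<^sub>v w"
    and supp: "\<And>i. i < n \<Longrightarrow> z $ i = 0 \<Longrightarrow> w $ i = 0"
  shows "t \<le> s"
proof -
  have dz: "dim_vec z = n" and zn: "\<And>i. i < n \<Longrightarrow> 0 \<le> z $ i"
    using z0 by (auto simp: less_eq_vec_def)
  have dw: "dim_vec w = n" and wn: "\<And>i. i < n \<Longrightarrow> 0 \<le> w $ i"
    using w0 by (auto simp: less_eq_vec_def)
  define I where "I = {i. i < n \<and> z $ i > 0}"
  obtain j where j: "j < n" "w $ j \<noteq> 0" using wne dw by (metis eq_vecI index_zero_vec)
  then have jI: "j \<in> I" using supp[of j] zn[of j] by (auto simp: I_def order.strict_iff_order)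
  have fin: "finite ((\<lambda>i. w $ i / z $ i) ` I)" by (simp add: I_def)
  have "Max ((\<lambda>i. w $ i / z $ i) ` I) \<in> (\<lambda>i. w $ i / z $ i) ` I"
    using fin jI by (intro Max_in) auto
  then obtain i where i: "i \<in> I" "Max ((\<lambda>i. w $ i / z $ i) ` I) = w $ i / z $ i" by auto
  \<comment> \<open>The least r with w \<le> r z is attained at i, where the two inequalities are compared.\<close>
  define r where "r = w $ i / z $ i"
  have max: "w $ l / z $ l \<le> r" if "l \<in> I" for l
    using that fin unfolding r_def i(2)[symmetric] by (intro Max_ge) auto
  have zi: "z $ i > 0" "i < n" using i(1) by (auto simp: I_def)
  have "0 < w $ j / z $ j" using jI j wn[of j] by (auto simp: I_def)
  then have r0: "r > 0" using max[OF jI] by simp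
  have "w $ l \<le> r * z $ l" if "l < n" for l
  proof (cases "z $ l = 0")
    case True
    then show ?thesis using supp that by simp
  next
    case False
    then have "l \<in> I" using that zn[of l] by (auto simp: I_def)
    then show ?thesis using max[of l] by (simp add: I_def field_simps)
  qed
  then have "w \<le> r \<cdot>\<^sub>v z" using dz dw by (auto simp: less_eq_vec_def)
  then have "T *\<^sub>v w \<le> T *\<^sub>v (r \<cdot>\<^sub>v z)"
    using T T0 dz by (intro mult_mat_vec_mono) auto
  also have "\<dots> = r \<cdot>\<^sub>v (T *\<^sub>v z)" using T dz by (intro mult_mat_vec[of _ n n]) (auto intro: carrier_vecI)
  finally have "t * w $ i \<le> r * (T *\<^sub>v z) $ i"
    using Tw T dw zi by (fastforce simp: less_eq_vec_def)
  also have "\<dots> \<le> r * (s * z $ i)"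
    using Tz r0 zi dz by (intro mult_left_mono) (auto simp: less_eq_vec_def)
  also have "\<dots> = s * w $ i" using zi by (simp add: r_def)
  finally show ?thesis using r0 zi by (simp add: r_def zero_less_divide_iff)
qed

section \<open>Block companion matrices\<close>

text \<open>The vector \<open>(s x, x)\<close> is superinvariant for the companion matrix with
  factor \<open>s\<close>, and is compared with the modulus of an arbitrary eigenvector. The
  condition on vanishing rows supplies the support condition of that comparison.\<close>

lemma companion_spectral_radius_le:
  assumes X: "X \<in> carrier_mat n n" "nonneg_mat X" and Y: "Y \<in> carrier_mat n n" "nonneg_mat Y"
    and n: "n > 0" and x0: "0\<^sub>v n \<le> x" and s: "s > 0"
    and le: "\<And>i. i < n \<Longrightarrow> s * (X *\<^sub>v x) $ i + (Y *\<^sub>v x) $ i \<le> s\<^sup>2 * x $ i"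
    and supp: "\<And>i j. i < n \<Longrightarrow> j < n \<Longrightarrow> x $ i = 0 \<Longrightarrow> X $$ (i,j) = 0 \<and> Y $$ (i,j) = 0"
  shows "spectral_radius (cplx (four_block_mat X Y (1\<^sub>m n) (0\<^sub>m n n))) \<le> s"
proof (rule spectral_radius_leI[of _ "n + n"])
  let ?T = "four_block_mat X Y (1\<^sub>m n) (0\<^sub>m n n)"
  have T: "?T \<in> carrier_mat (n + n) (n + n)" using X Y by auto
  have T0: "nonneg_mat ?T"
    using X Y by (auto simp: nonneg_mat_def)
  have xc: "x \<in> carrier_vec n" using x0 by (auto simp: less_eq_vec_def)
  show "cplx ?T \<in> carrier_mat (n + n) (n + n)" "n + n > 0" using T n by auto
  fix k assume ev: "eigenvalue (cplx ?T) k"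
  show "norm k \<le> s"
  proof (rule ccontr)
    assume "\<not> norm k \<le> s"
    then have k: "norm k > 0" using s by linarith
    obtain w where w: "0\<^sub>v (n + n) \<le> w" "w \<noteq> 0\<^sub>v (n + n)" "norm k \<cdot>\<^sub>v w \<le> ?T *\<^sub>v w"
      using eigenvalue_abs_subinvariant[OF T T0 ev] by blast
    define u v where "u = vec_first w n" and "v = vec_last w n"
    have uv: "u \<in> carrier_vec n" "v \<in> carrier_vec n" by (auto simp: u_def v_def)
    have wuv: "w = u @\<^sub>v v"
      using w(1) unfolding u_def v_def by (intro vec_first_last_append[symmetric]) (auto simp: less_eq_vec_def)
    have Tapp: "?T *\<^sub>v (a @\<^sub>v b) = (X *\<^sub>v a + Y *\<^sub>v b) @\<^sub>v a"
      if "a \<in> carrier_vec n" "b \<in> carrier_vec n" for a b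
    proof -
      have "0\<^sub>m n n *\<^sub>v b = 0\<^sub>v n" using that by (intro eq_vecI) auto
      then show ?thesis
        using that four_block_mat_mult_vec[OF X(1) Y(1) one_carrier_mat zero_carrier_mat, of a b]
        by simp
    qed
    have ge0: "u $ i \<ge> 0" "v $ i \<ge> 0" if "i < n" for i
    proof -
      have "(u @\<^sub>v v) $ i \<ge> 0" "(u @\<^sub>v v) $ (n + i) \<ge> 0"
        using w(1) that unfolding wuv by (auto simp: less_eq_vec_def simp del: index_append_vec)
      then show "u $ i \<ge> 0" "v $ i \<ge> 0" using that uv by auto
    qed
    have sub: "norm k * u $ i \<le> (X *\<^sub>v u + Y *\<^sub>v v) $ i" "norm k * v $ i \<le> u $ i" if "i < n" for i
    proof -
      have "\<forall>j<n+n. (norm k \<cdot>\<^sub>v (u @\<^sub>v v)) $ j \<le> ((X *\<^sub>v u + Y *\<^sub>v v) @\<^sub>v u) $ j"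
        using w(3) uv X Y unfolding wuv Tapp[OF uv] by (simp add: less_eq_vec_def)
      from this[rule_format, of i] this[rule_format, of "n + i"]
      show "norm k * u $ i \<le> (X *\<^sub>v u + Y *\<^sub>v v) $ i" "norm k * v $ i \<le> u $ i"
        using that uv X Y by auto
    qed
    \<comment> \<open>Zero rows of \<open>X\<close> and \<open>Y\<close> give
      \<open>norm k * u $ i \<le> 0\<close>; then the second block row,
      \<open>norm k * v \<le> u\<close>, forces \<open>v $ i\<close> to vanish as well.\<close>
    have zero: "u $ i = 0" "v $ i = 0" if "i < n" "x $ i = 0" for i
    proof -
      have "(X *\<^sub>v u) $ i = 0" "(Y *\<^sub>v v) $ i = 0"
        using that X Y uv supp[of i] by (auto simp: mult_mat_vec_entry simp del: index_mult_mat_vec)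
      then have "norm k * u $ i \<le> 0" using sub(1)[of i] that X Y by simp
      then show "u $ i = 0" using ge0(1)[of i] that k by (simp add: mult_le_0_iff)
      then have "norm k * v $ i \<le> 0" using sub(2)[of i] that by simp
      then show "v $ i = 0" using ge0(2)[of i] that k by (simp add: mult_le_0_iff)
    qed
    \<comment> \<open>For this vector the second block of the superinvariance is an equality, and
      the first block is the hypothesis \<open>le\<close>.\<close>
    let ?z = "(s \<cdot>\<^sub>v x) @\<^sub>v x"
    have Xs: "X *\<^sub>v (s \<cdot>\<^sub>v x) = s \<cdot>\<^sub>v (X *\<^sub>v x)" using X xc by (simp add: mult_mat_vec)
    have "norm k \<le> s"
    proof (rule subinvariant_le_superinvariant[OF T T0 _ _ w])
      show "0\<^sub>v (n + n) \<le> ?z"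
        using x0 s xc by (auto simp: less_eq_vec_def)
      show "?T *\<^sub>v ?z \<le> s \<cdot>\<^sub>v ?z"
        using xc X Y le by (subst Tapp) (auto simp: Xs less_eq_vec_def power2_eq_square mult.assoc)
      show "w $ i = 0" if "i < n + n" "?z $ i = 0" for i
        using that xc uv zero[of i] zero[of "i - n"] s unfolding wuv by (auto split: if_splits)
    qed
    then show False using \<open>\<not> norm k \<le> s\<close> by simp
  qed
qed

lemma nonneg_mat_mult:
  assumes "nonneg_mat M" "nonneg_mat N" "dim_col M = dim_row N"
  shows "nonneg_mat (M * N)"
  using assms by (auto simp: nonneg_mat_def scalar_prod_def intro!: sum_nonneg)

lemma nonneg_mult_mat_vec_entry:
  assumes "M \<in> carrier_mat m n" "nonneg_mat M" "0\<^sub>v n \<le> v" "i < m"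
  shows "0 \<le> (M *\<^sub>v v) $ i"
  using mult_mat_vec_nonneg[OF assms(2,3), of m] assms(1,4) by (simp add: less_eq_vec_def)

lemma nonpos_iff_nonneg_uminus: "nonpos_mat M \<longleftrightarrow> nonneg_mat (- M)"
  by (auto simp: nonpos_mat_def nonneg_mat_def)

text \<open>The product with the all-ones vector lists the row sums, and a zero sum of nonnegative
  entries has only zero terms.\<close>

lemma mult_ones_eq_0_imp_row_eq_0:
  assumes H: "H \<in> carrier_mat m n" "nonneg_mat H" and i: "i < m" and j: "j < n"
    and z: "(H *\<^sub>v vec n (\<lambda>_. 1)) $ i = 0"
  shows "H $$ (i,j) = 0"
proof -
  have "(\<Sum>l<n. H $$ (i,l)) = 0"
    using z i H(1) by (subst (asm) mult_mat_vec_entry) auto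
  then show ?thesis
    by (subst (asm) sum_nonneg_eq_0_iff) (use H i j in \<open>auto simp: nonneg_mat_def\<close>)
qed

text \<open>Linearization of the quadratic equation: solve the resolvent equation of the companion
  matrix with right-hand side \<open>(h, 0)\<close>. Its second block row forces the first half of
  the solution to be \<open>s\<close> times the second half \<open>x\<close>.\<close>

lemma companion_resolvent:
  assumes X: "X \<in> carrier_mat n n" "nonneg_mat X" and Y: "Y \<in> carrier_mat n n" "nonneg_mat Y"
    and s: "spectral_radius (cplx (four_block_mat X Y (1\<^sub>m n) (0\<^sub>m n n))) < s" and h: "0\<^sub>v n \<le> h"
  obtains x where "0\<^sub>v n \<le> x" "s\<^sup>2 \<cdot>\<^sub>v x = s \<cdot>\<^sub>v (X *\<^sub>v x) + Y *\<^sub>v x + h"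
proof -
  let ?T = "four_block_mat X Y (1\<^sub>m n) (0\<^sub>m n n)"
  have T: "?T \<in> carrier_mat (n + n) (n + n)" "nonneg_mat ?T"
    using X Y by (auto simp: nonneg_mat_def)
  have hc: "h \<in> carrier_vec n" using h by (auto simp: less_eq_vec_def)
  have "0\<^sub>v (n + n) \<le> h @\<^sub>v 0\<^sub>v n" using h hc by (auto simp: less_eq_vec_def)
  then obtain y where y: "0\<^sub>v (n + n) \<le> y" "s \<cdot>\<^sub>v y = ?T *\<^sub>v y + (h @\<^sub>v 0\<^sub>v n)"
    using nonneg_resolvent[OF T s] by blast
  define u x where "u = vec_first y n" and "x = vec_last y n"
  have c: "u \<in> carrier_vec n" "x \<in> carrier_vec n" by (auto simp: u_def x_def)
  have yux: "y = u @\<^sub>v x"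
    using y(1) unfolding u_def x_def by (intro vec_first_last_append[symmetric]) (auto simp: less_eq_vec_def)
  have x0: "0 \<le> x $ i" if "i < n" for i
  proof -
    have "(u @\<^sub>v x) $ (n + i) \<ge> 0" using y(1) that unfolding yux by (auto simp: less_eq_vec_def simp del: index_append_vec)
    then show ?thesis using that c by auto
  qed
  have "0\<^sub>m n n *\<^sub>v x = 0\<^sub>v n" using c by (intro eq_vecI) auto
  then have "?T *\<^sub>v y = (X *\<^sub>v u + Y *\<^sub>v x) @\<^sub>v u"
    using c four_block_mat_mult_vec[OF X(1) Y(1) one_carrier_mat zero_carrier_mat, of u x]
    by (simp add: yux)
  then have eq: "s \<cdot>\<^sub>v (u @\<^sub>v x) = ((X *\<^sub>v u + Y *\<^sub>v x) @\<^sub>v u) + (h @\<^sub>v 0\<^sub>v n)"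
    using y(2) unfolding yux by simp
  have ux: "u = s \<cdot>\<^sub>v x"
  proof (rule eq_vecI)
    fix i assume "i < dim_vec (s \<cdot>\<^sub>v x)"
    then have i: "i < n" using c by simp
    then show "u $ i = (s \<cdot>\<^sub>v x) $ i"
      using arg_cong[OF eq, of "\<lambda>v. v $ (n + i)"] c X Y hc by simp
  qed (use c in simp)
  have Xu: "X *\<^sub>v u = s \<cdot>\<^sub>v (X *\<^sub>v x)" unfolding ux using X c by (simp add: mult_mat_vec)
  have "s\<^sup>2 \<cdot>\<^sub>v x = s \<cdot>\<^sub>v (X *\<^sub>v x) + Y *\<^sub>v x + h"
  proof (rule eq_vecI)
    fix i assume "i < dim_vec (s \<cdot>\<^sub>v (X *\<^sub>v x) + Y *\<^sub>v x + h)"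
    then have i: "i < n" using hc by simp
    then have "s * u $ i = (X *\<^sub>v u) $ i + (Y *\<^sub>v x) $ i + h $ i"
      using arg_cong[OF eq, of "\<lambda>v. v $ i"] c X Y hc by (simp del: index_mult_mat_vec)
    then show "(s\<^sup>2 \<cdot>\<^sub>v x) $ i = (s \<cdot>\<^sub>v (X *\<^sub>v x) + Y *\<^sub>v x + h) $ i"
      using i c X Y hc unfolding Xu by (simp add: ux power2_eq_square mult.assoc)
  qed (use c hc in auto)
  then show ?thesis using that[of x] x0 c by (auto simp: less_eq_vec_def)
qed

section \<open>The Moore-Penrose inverse\<close>

text \<open>The library versions of these laws have carrier premises whose dimensions do not occur in the
  conclusion; stated with dimension equations they work as rewrite rules.\<close>

lemma mat_assoc: "dim_col A = dim_row B \<Longrightarrow> dim_col B = dim_row C \<Longrightarrow> A * B * C = A * (B * C)"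
  for A B C :: "'a::semiring_0 mat"
  by (rule assoc_mult_mat) auto

lemma mat_diff_mult: "dim_row A = dim_row B \<Longrightarrow> dim_col A = dim_col B \<Longrightarrow> dim_col B = dim_row C
    \<Longrightarrow> (A - B) * C = A * C - B * C"
  for A B C :: "'a::ring mat"
  by (rule minus_mult_distrib_mat) auto

lemma mat_mult_diff: "dim_row B = dim_row C \<Longrightarrow> dim_col B = dim_col C \<Longrightarrow> dim_col A = dim_row B
    \<Longrightarrow> A * (B - C) = A * B - A * C"
  for A B C :: "'a::ring mat"
  by (rule mult_minus_distrib_mat) auto

lemma mat_vec_assoc: "dim_col A = dim_row B \<Longrightarrow> dim_col B = dim_vec v
    \<Longrightarrow> A * B *\<^sub>v v = A *\<^sub>v (B *\<^sub>v v)"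
  for A B :: "'a::semiring_0 mat"
  by (rule assoc_mult_mat_vec) (auto intro: carrier_vecI)

lemma mat_diff_vec: "dim_row A = dim_row B \<Longrightarrow> dim_col A = dim_col B \<Longrightarrow> dim_col B = dim_vec v
    \<Longrightarrow> (A - B) *\<^sub>v v = A *\<^sub>v v - B *\<^sub>v v"
  for A B :: "'a::ring mat"
  by (rule minus_mult_distrib_mat_vec) (auto intro: carrier_vecI)

lemma mult_unit_vec_col:
  "M \<in> carrier_mat m n \<Longrightarrow> j < n \<Longrightarrow> M *\<^sub>v unit_vec n j = col M j"
  for M :: "'a::semiring_1 mat"
  by (intro eq_vecI) auto

lemma mat_transpose_mult: "dim_col A = dim_row B
    \<Longrightarrow> transpose_mat (A * B) = transpose_mat B * transpose_mat A"
  for A B :: "'a::comm_semiring_0 mat"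
  by (rule transpose_mult) auto

section \<open>Existence of generalized inverses\<close>

text \<open>Elimination by induction on the number of nonzero rows: subtracting a rank-one matrix
  clears the pivot row and leaves zero rows zero.\<close>

lemma inner_inverse_exists:
  fixes A :: "'a::field mat"
  assumes "A \<in> carrier_mat m n"
  shows "\<exists>G \<in> carrier_mat n m. A * G * A = A"
  using assms
proof (induction "card {i. i < m \<and> (\<exists>j<n. A $$ (i,j) \<noteq> 0)}" arbitrary: A rule: less_induct)
  case less
  note A = less.prems
  show ?case
  proof (cases "\<exists>i<m. \<exists>j<n. A $$ (i,j) \<noteq> 0")
    case False
    then have "A * 0\<^sub>m n m * A = A" using A by (intro eq_matI) auto
    then show ?thesis by (intro bexI[of _ "0\<^sub>m n m"]) auto
  next
    case True
    then obtain i j where ij: "i < m" "j < n" "A $$ (i,j) \<noteq> 0" by blast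
    \<comment> \<open>\<open>J\<close> has the inverse of the pivot as its only nonzero entry, so
      \<open>A J A\<close> is the pivot column times the pivot row divided by the pivot.\<close>
    define J where "J = mat n m (\<lambda>(k,l). if k = j \<and> l = i then 1 / A $$ (i,j) else 0)"
    have J: "J \<in> carrier_mat n m" by (simp add: J_def)
    have "(J * A) $$ (k,l) = (if k = j then A $$ (i,l) / A $$ (i,j) else 0)" if "k < n" "l < n" for k l
      using that A ij by (auto simp: J_def scalar_prod_def if_distrib[of "\<lambda>x. x * _"] sum.delta' cong: if_cong)
    then have AJA: "(A * (J * A)) $$ (k,l) = A $$ (k,j) * A $$ (i,l) / A $$ (i,j)" if "k < m" "l < n" for k l
      using that A J ij by (simp add: scalar_prod_def if_distrib[of "\<lambda>x. _ * x"] sum.delta' cong: if_cong)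
    \<comment> \<open>Pivoting at (i,j): A - A J A has fewer nonzero rows, and any inner inverse of it lifts to one of A.\<close>
    define A' where "A' = A - A * (J * A)"
    have A': "A' \<in> carrier_mat m n" using A J by (auto simp: A'_def)
    have A'_entry: "A' $$ (k,l) = A $$ (k,l) - A $$ (k,j) * A $$ (i,l) / A $$ (i,j)" if "k < m" "l < n" for k l
      using that A J AJA[OF that] by (simp add: A'_def del: index_mult_mat(1))
    have "{k. k < m \<and> (\<exists>l<n. A' $$ (k,l) \<noteq> 0)} \<subset> {k. k < m \<and> (\<exists>l<n. A $$ (k,l) \<noteq> 0)}"
    proof (intro psubsetI subsetI)
      fix k assume "k \<in> {k. k < m \<and> (\<exists>l<n. A' $$ (k,l) \<noteq> 0)}"
      then obtain l where l: "k < m" "l < n" "A' $$ (k,l) \<noteq> 0" by blast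
      then have "A $$ (k,l) \<noteq> 0 \<or> A $$ (k,j) \<noteq> 0" using A'_entry[of k l] by auto
      then show "k \<in> {k. k < m \<and> (\<exists>l<n. A $$ (k,l) \<noteq> 0)}" using l ij(2) by blast
    next
      have "i \<notin> {k. k < m \<and> (\<exists>l<n. A' $$ (k,l) \<noteq> 0)}" using A'_entry ij by auto
      then show "{k. k < m \<and> (\<exists>l<n. A' $$ (k,l) \<noteq> 0)} \<noteq> {k. k < m \<and> (\<exists>l<n. A $$ (k,l) \<noteq> 0)}"
        using ij by blast
    qed
    then have "card {k. k < m \<and> (\<exists>l<n. A' $$ (k,l) \<noteq> 0)} < card {k. k < m \<and> (\<exists>l<n. A $$ (k,l) \<noteq> 0)}"
      by (intro psubset_card_mono) auto
    from less.hyps[OF this A'] obtain G where G: "G \<in> carrier_mat n m" "A' * G * A' = A'" by blast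
    \<comment> \<open>The outer factors are chosen so that \<open>A L A = A' G A' = A'\<close>;
      adding \<open>J\<close> to \<open>L\<close> then restores the subtracted term
      \<open>A J A\<close>.\<close>
    define L where "L = (1\<^sub>m n - J * A) * G * (1\<^sub>m m - A * J)"
    have L: "L \<in> carrier_mat n m" using A J G by (auto simp: L_def)
    have l: "A * (1\<^sub>m n - J * A) = A'" and r: "(1\<^sub>m m - A * J) * A = A'"
      using A J by (simp_all add: A'_def mat_mult_diff mat_diff_mult mat_assoc)
    have "A * L * A = (A * (1\<^sub>m n - J * A)) * G * ((1\<^sub>m m - A * J) * A)"
      using A J G by (simp add: L_def mat_assoc)
    then have ALA: "A * L * A = A'" unfolding l r G(2) .
    have "A * (L + J) * A = A * L * A + A * (J * A)"
      using A J L by (simp add: add_mult_distrib_mat[of _ m m] mult_add_distrib_mat[of _ m n] mat_assoc)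
    also have "\<dots> = A" unfolding ALA using A J by (intro eq_matI) (auto simp: A'_def)
    finally show ?thesis using L J by (intro bexI[of _ "L + J"]) auto
  qed
qed

text \<open>For \<open>E = M (C - D)\<close> the hypothesis gives
  \<open>E^T E = (C - D)^T M^T E = 0\<close>. The diagonal entries of \<open>E^T E\<close> are sums
  of squares of the columns of \<open>E\<close>, so over the reals \<open>E\<close> is zero.\<close>

lemma gram_cancel:
  fixes M C D :: "real mat"
  assumes M: "M \<in> carrier_mat m n" and C: "C \<in> carrier_mat n k" and D: "D \<in> carrier_mat n k"
    and eq: "transpose_mat M * (M * C) = transpose_mat M * (M * D)"
  shows "M * C = M * D"
proof -
  define E where "E = M * C - M * D"
  have E: "E \<in> carrier_mat m k" using M C D by (auto simp: E_def)
  have "transpose_mat M * E = transpose_mat M * (M * C) - transpose_mat M * (M * D)"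
    unfolding E_def using M C D by (intro mat_mult_diff) auto
  then have ME: "transpose_mat M * E = 0\<^sub>m n k" unfolding eq using M D by (intro eq_matI) auto
  have "E = M * (C - D)" using M C D by (simp add: E_def mat_mult_diff)
  then have "transpose_mat E * E = transpose_mat (C - D) * (transpose_mat M * E)"
    using M C D E by (simp add: mat_transpose_mult mat_assoc)
  then have EE: "transpose_mat E * E = 0\<^sub>m k k" unfolding ME using C D by simp
  have "E $$ (i,j) = 0" if i: "i < m" and j: "j < k" for i j
  proof -
    have "(transpose_mat E * E) $$ (j,j) = 0" using EE j by simp
    then have "(\<Sum>l<m. E $$ (l,j) * E $$ (l,j)) = 0"
      using E j by (simp add: scalar_prod_def atLeast0LessThan)
    then have "\<forall>l\<in>{..<m}. E $$ (l,j) * E $$ (l,j) = 0"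
      by (subst (asm) sum_nonneg_eq_0_iff) auto
    then show ?thesis using i by simp
  qed
  note z = this
  show ?thesis
  proof (rule eq_matI)
    fix i j assume "i < dim_row (M * D)" "j < dim_col (M * D)"
    then have ij: "i < m" "j < k" using M D by auto
    show "(M * C) $$ (i,j) = (M * D) $$ (i,j)" using z[OF ij] ij M C D unfolding E_def by simp
  qed (use M C D in auto)
qed

text \<open>Take \<open>Y = G M^T\<close> with \<open>G\<close> an inner inverse of
  \<open>M^T M\<close>. Cancelling \<open>M^T\<close> gives \<open>M G M^T M = M\<close>. Although
  \<open>G\<close> may fail to be symmetric,
  \<open>M G M^T = (M G M^T M) G^T M^T = M G^T M^T\<close>, so \<open>M Y\<close> is
  symmetric.\<close>

lemma least_squares_inverse_exists:
  fixes M :: "real mat"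
  assumes M: "M \<in> carrier_mat m n"
  shows "\<exists>Y \<in> carrier_mat n m. M * Y * M = M \<and> transpose_mat (M * Y) = M * Y"
proof -
  let ?Mt = "transpose_mat M"
  have "?Mt * M \<in> carrier_mat n n" using M by auto
  from inner_inverse_exists[OF this]
  obtain G where G: "G \<in> carrier_mat n n" "?Mt * M * G * (?Mt * M) = ?Mt * M" by blast
  have "M * (G * (?Mt * M)) = M * 1\<^sub>m n"
    by (rule gram_cancel[OF M, of _ n]) (use G M in \<open>auto simp: mat_assoc\<close>)
  then have a: "M * (G * (?Mt * M)) = M" using M by simp
  from arg_cong[OF a, of transpose_mat]
  have b: "?Mt * (M * (transpose_mat G * ?Mt)) = ?Mt"
    using G M by (simp add: mat_transpose_mult mat_assoc)
  have "M * (G * ?Mt) = (M * (G * (?Mt * M))) * (transpose_mat G * ?Mt)"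
    by (subst b[symmetric]) (use G M in \<open>simp add: mat_assoc\<close>)
  then have "M * (G * ?Mt) = M * (transpose_mat G * ?Mt)" unfolding a .
  moreover have "transpose_mat (M * (G * ?Mt)) = M * (transpose_mat G * ?Mt)"
    using G M by (simp add: mat_transpose_mult mat_assoc)
  moreover have "M * (G * ?Mt) * M = M" using a G(1) M by (simp add: mat_assoc)
  ultimately show ?thesis using G(1) M by (intro bexI[of _ "G * ?Mt"]) auto
qed

text \<open>The four Penrose conditions are isolated as a predicate so that existence and uniqueness
  can be proved before the definite description in \<open>mp_inverse\<close> is resolved.\<close>

definition is_mp_inverse :: "real mat \<Rightarrow> real mat \<Rightarrow> bool" where
  "is_mp_inverse M X \<longleftrightarrow> X \<in> carrier_mat (dim_col M) (dim_row M) \<and>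
      M * X * M = M \<and> X * M * X = X \<and>
      transpose_mat (M * X) = M * X \<and> transpose_mat (X * M) = X * M"

text \<open>Urquhart's formula: the inverse is \<open>V M Y\<close>, where \<open>Y\<close> is an
  inner inverse with \<open>M Y\<close> symmetric and \<open>V\<close> is one with
  \<open>V M\<close> symmetric, the latter obtained by transposing a least squares inverse of
  \<open>M^T\<close>. The products with \<open>M\<close> collapse to \<open>M Y\<close> and
  \<open>V M\<close>.\<close>

lemma is_mp_inverse_exists: "\<exists>X. is_mp_inverse M X"
proof -
  define m n where "m = dim_row M" and "n = dim_col M"
  have M: "M \<in> carrier_mat m n" by (simp add: m_def n_def)
  obtain Y where Y: "Y \<in> carrier_mat n m" "M * Y * M = M" "transpose_mat (M * Y) = M * Y"
    using least_squares_inverse_exists[OF M] by blast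
  obtain Z where Z: "Z \<in> carrier_mat m n" "transpose_mat M * Z * transpose_mat M = transpose_mat M"
      "transpose_mat (transpose_mat M * Z) = transpose_mat M * Z"
    using least_squares_inverse_exists[of "transpose_mat M" n m] M by auto
  define V where "V = transpose_mat Z"
  have V: "V \<in> carrier_mat n m" using Z by (simp add: V_def)
  have VM: "transpose_mat (V * M) = V * M"
    using Z M by (simp add: V_def mat_transpose_mult)
  have MVM: "M * (V * M) = M"
    using arg_cong[OF Z(2), of transpose_mat] Z(1) M by (simp add: V_def mat_transpose_mult mat_assoc)
  have MYM: "M * (Y * M) = M" using Y M by (simp add: mat_assoc)
  have 1: "M * (V * M * Y) = M * Y" 
  proof -
    have "M * (V * M * Y) = M * (V * M) * Y" using M V Y by (simp add: mat_assoc)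
    then show ?thesis unfolding MVM .
  qed
  have 2: "V * M * Y * M = V * M" using M V Y MYM by (simp add: mat_assoc)
  have "V * M * Y * M * (V * M * Y) = V * (M * (V * M)) * Y" 
    unfolding 2 using M V Y by (simp add: mat_assoc)
  then have "V * M * Y * M * (V * M * Y) = V * M * Y" unfolding MVM .
  then have "is_mp_inverse M (V * M * Y)"
    unfolding is_mp_inverse_def 1 2 using M V Y VM by simp
  then show ?thesis ..
qed

section \<open>Orthogonal projections and uniqueness\<close>

text \<open>Both sides are symmetric projections, each fixing the range of the other. Hence
  \<open>P X = (A Y) (P X)\<close>, and transposing turns the right-hand side into
  \<open>(P X) (A Y) = A Y\<close>. The lemma serves both uniqueness, with \<open>A = P\<close>, and
  the comparison of a splitting with its matrix.\<close>

lemma mp_range_projection_eq: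
  assumes P: "P \<in> carrier_mat m n" and A: "A \<in> carrier_mat m k"
    and X: "is_mp_inverse P X" and Y: "is_mp_inverse A Y"
    and PA: "A * Y * P = P" and AP: "P * X * A = A"
  shows "P * X = A * Y"
proof -
  have c: "X \<in> carrier_mat n m" "Y \<in> carrier_mat k m"
    and s: "transpose_mat (P * X) = P * X" "transpose_mat (A * Y) = A * Y"
    using X Y P A by (auto simp: is_mp_inverse_def)
  have "P * X = (A * Y) * (P * X)"
    using P A c by (subst PA[symmetric]) (simp add: mat_assoc)
  also have "\<dots> = transpose_mat ((P * X) * (A * Y))"
    using P A c s by (subst mat_transpose_mult) auto
  also have "(P * X) * (A * Y) = A * Y"
    using P A c by (subst (2) AP[symmetric]) (simp add: mat_assoc)
  finally show ?thesis using s by simp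
qed

lemma is_mp_inverse_transpose:
  assumes "is_mp_inverse M X"
  shows "is_mp_inverse (transpose_mat M) (transpose_mat X)"
proof -
  have X: "X \<in> carrier_mat (dim_col M) (dim_row M)"
    and eq: "M * X * M = M" "X * M * X = X"
    "transpose_mat (M * X) = M * X" "transpose_mat (X * M) = X * M"
    using assms by (auto simp: is_mp_inverse_def)
  let ?Mt = "transpose_mat M" and ?Xt = "transpose_mat X"
  have "?Mt * ?Xt * ?Mt = ?Mt" "?Xt * ?Mt * ?Xt = ?Xt"
    using arg_cong[OF eq(1), of transpose_mat] arg_cong[OF eq(2), of transpose_mat] X
    by (simp_all add: mat_transpose_mult mat_assoc)
  moreover have "?Mt * ?Xt = X * M" "?Xt * ?Mt = M * X"
    using eq(3,4) X by (simp_all add: mat_transpose_mult)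
  ultimately show ?thesis using X eq(3,4) by (simp add: is_mp_inverse_def)
qed

text \<open>The dual for row spaces, obtained by applying the range version to transposes.\<close>

lemma mp_corange_projection_eq:
  assumes P: "P \<in> carrier_mat m n" and A: "A \<in> carrier_mat k n"
    and X: "is_mp_inverse P X" and Y: "is_mp_inverse A Y"
    and PA: "P * (Y * A) = P" and AP: "A * (X * P) = A"
  shows "X * P = Y * A"
proof -
  have c: "X \<in> carrier_mat n m" "Y \<in> carrier_mat n k"
    and s: "transpose_mat (X * P) = X * P" "transpose_mat (Y * A) = Y * A"
    using X Y P A by (auto simp: is_mp_inverse_def)
  have "transpose_mat P * transpose_mat X = transpose_mat A * transpose_mat Y"
    using arg_cong[OF PA, of transpose_mat] arg_cong[OF AP, of transpose_mat] P A c
    by (intro mp_range_projection_eq[OF _ _ is_mp_inverse_transpose[OF X] is_mp_inverse_transpose[OF Y], of n m k])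
      (auto simp: mat_transpose_mult mat_assoc)
  then show ?thesis using s P A c by (simp add: mat_transpose_mult)
qed

text \<open>Both projections agree, \<open>M X = M Y\<close> and \<open>X M = Y M\<close>, so
  \<open>X = X M X = X M Y = Y M Y = Y\<close>.\<close>

lemma is_mp_inverse_unique:
  assumes X: "is_mp_inverse M X" and Y: "is_mp_inverse M Y"
  shows "X = Y"
proof -
  define m n where "m = dim_row M" and "n = dim_col M"
  have M: "M \<in> carrier_mat m n" by (simp add: m_def n_def)
  have c: "X \<in> carrier_mat n m" "Y \<in> carrier_mat n m"
    and eq: "M * X * M = M" "X * M * X = X" "M * Y * M = M" "Y * M * Y = Y"
    using X Y by (auto simp: is_mp_inverse_def m_def n_def)
  have 1: "M * X = M * Y"
    using mp_range_projection_eq[OF M M X Y] eq by simp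
  have 2: "X * M = Y * M"
    using mp_corange_projection_eq[OF M M X Y] eq M c by (simp add: mat_assoc)
  have "X = X * (M * X)" using eq M c by (simp add: mat_assoc)
  also have "\<dots> = X * M * Y" unfolding 1 using M c by (simp add: mat_assoc)
  also have "\<dots> = Y" unfolding 2 by (rule eq)
  finally show ?thesis .
qed

lemma mp_inverse_is_mp_inverse: "is_mp_inverse M (M\<^sup>\<dagger>)"
proof -
  have "\<exists>!X. is_mp_inverse M X" using is_mp_inverse_exists is_mp_inverse_unique by blast
  then show ?thesis unfolding mp_inverse_def is_mp_inverse_def[symmetric] by (rule theI')
qed

lemma mp_inverse_carrier [simp]: "M\<^sup>\<dagger> \<in> carrier_mat n m \<longleftrightarrow> M \<in> carrier_mat m n"
  and dim_mp_inverse [simp]: "dim_row (M\<^sup>\<dagger>) = dim_col M" "dim_col (M\<^sup>\<dagger>) = dim_row M"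
proof -
  have "M\<^sup>\<dagger> \<in> carrier_mat (dim_col M) (dim_row M)"
    using mp_inverse_is_mp_inverse[of M] unfolding is_mp_inverse_def by blast
  then show d: "dim_row (M\<^sup>\<dagger>) = dim_col M" "dim_col (M\<^sup>\<dagger>) = dim_row M"
    by (rule carrier_matD)+
  show "M\<^sup>\<dagger> \<in> carrier_mat n m \<longleftrightarrow> M \<in> carrier_mat m n"
    unfolding carrier_mat_def mem_Collect_eq d by (rule conj_commute)
qed

lemma mp_inverse_outer: "M\<^sup>\<dagger> * M * M\<^sup>\<dagger> = M\<^sup>\<dagger>"
  using mp_inverse_is_mp_inverse[of M] by (simp add: is_mp_inverse_def)

section \<open>Range and null space inclusions as projection identities\<close>

text \<open>\<open>P * P\<^sup>\<dagger>\<close> fixes every vector in the range of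
  \<open>P\<close>, in particular each column of \<open>S\<close>, which is the image of a unit
  vector.\<close>

lemma range_space_subset_imp_projection:
  assumes S: "S \<in> carrier_mat m k" and P: "P \<in> carrier_mat m n"
    and sub: "range_space S \<subseteq> range_space P"
  shows "P * P\<^sup>\<dagger> * S = S"
proof -
  have c: "P\<^sup>\<dagger> \<in> carrier_mat n m" and eq: "P * P\<^sup>\<dagger> * P = P"
    using mp_inverse_is_mp_inverse[of P] P by (auto simp: is_mp_inverse_def)
  have PP: "P * P\<^sup>\<dagger> * S \<in> carrier_mat m k" using P S c by auto
  show ?thesis
  proof (rule mat_col_eqI)
    fix j assume "j < dim_col S"
    then have j: "j < k" using S by simp
    have "S *\<^sub>v unit_vec k j \<in> range_space S"
      using S by (auto simp: range_space_def)
    then obtain x where x: "x \<in> carrier_vec n" "S *\<^sub>v unit_vec k j = P *\<^sub>v x"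
      using sub P by (auto simp: range_space_def)
    have "col (P * P\<^sup>\<dagger> * S) j = P * P\<^sup>\<dagger> * S *\<^sub>v unit_vec k j"
      using PP j by (rule mult_unit_vec_col[symmetric])
    also have "\<dots> = P * P\<^sup>\<dagger> *\<^sub>v (S *\<^sub>v unit_vec k j)"
      using P c S by (intro assoc_mult_mat_vec[of _ m m _ k]) auto
    also have "\<dots> = P * P\<^sup>\<dagger> * P *\<^sub>v x"
      unfolding x(2) using P c x by (intro assoc_mult_mat_vec[symmetric, of _ m m _ n]) auto
    also have "\<dots> = S *\<^sub>v unit_vec k j" unfolding eq x(2) ..
    also have "\<dots> = col S j" using S j by (rule mult_unit_vec_col)
    finally show "col (P * P\<^sup>\<dagger> * S) j = col S j" .
  qed (use P S c in auto)
qed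

text \<open>Subtracting from a unit vector its image under \<open>P\<^sup>\<dagger> * P\<close>
  leaves a vector in the null space of \<open>P\<close>, which \<open>S\<close> annihilates.\<close>

lemma null_space_subset_imp_projection:
  assumes S: "S \<in> carrier_mat k n" and P: "P \<in> carrier_mat m n"
    and sub: "null_space P \<subseteq> null_space S"
  shows "S * (P\<^sup>\<dagger> * P) = S"
proof -
  have c: "P\<^sup>\<dagger> \<in> carrier_mat n m" and eq: "P * P\<^sup>\<dagger> * P = P"
    using mp_inverse_is_mp_inverse[of P] P by (auto simp: is_mp_inverse_def)
  have SP: "S * (P\<^sup>\<dagger> * P) \<in> carrier_mat k n" using P S c by auto
  show ?thesis
  proof (rule mat_col_eqI)
    fix j assume "j < dim_col S"
    then have j: "j < n" using S by simp
    define y where "y = P\<^sup>\<dagger> *\<^sub>v (P *\<^sub>v unit_vec n j)"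
    have y: "y \<in> carrier_vec n" using c P by (simp add: y_def)
    have "P *\<^sub>v y = P * P\<^sup>\<dagger> * P *\<^sub>v unit_vec n j"
      using P c by (simp add: y_def mat_vec_assoc)
    then have "P *\<^sub>v (unit_vec n j - y) = 0\<^sub>v m"
      unfolding eq using P y by (simp add: mult_minus_distrib_mat_vec[of _ m n])
    then have "unit_vec n j - y \<in> null_space P" using P y by (auto simp: null_space_def)
    then have "S *\<^sub>v (unit_vec n j - y) = 0\<^sub>v k" using sub S by (auto simp: null_space_def)
    then have d: "S *\<^sub>v unit_vec n j - S *\<^sub>v y = 0\<^sub>v k"
      using S y by (simp add: mult_minus_distrib_mat_vec[of _ k n])
    have "S *\<^sub>v y = S *\<^sub>v unit_vec n j"
    proof (rule eq_vecI)
      fix i assume "i < dim_vec (S *\<^sub>v unit_vec n j)"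
      then have i: "i < k" using S by simp
      have "(S *\<^sub>v unit_vec n j - S *\<^sub>v y) $ i = 0" unfolding d using i by simp
      then show "(S *\<^sub>v y) $ i = (S *\<^sub>v unit_vec n j) $ i" using i S by simp
    qed (use S in auto)
    moreover have "S * (P\<^sup>\<dagger> * P) *\<^sub>v unit_vec n j = S *\<^sub>v y"
      using P c S by (simp add: y_def mat_vec_assoc)
    ultimately have "S * (P\<^sup>\<dagger> * P) *\<^sub>v unit_vec n j = S *\<^sub>v unit_vec n j" by simp
    then show "col (S * (P\<^sup>\<dagger> * P)) j = col S j"
      by (simp only: mult_unit_vec_col[OF SP j] mult_unit_vec_col[OF S j])
  qed (use P S c in auto)
qed

section \<open>Double splittings\<close>

text \<open>Equal ranges give equal orthogonal projections onto them, and equal null spaces give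
  equal projections onto their orthogonal complements. These identities allow \<open>P\<close> and
  \<open>A\<close> to be exchanged inside products.\<close>

lemma double_proper_splitting_projections:
  assumes A: "A \<in> carrier_mat m n" and sp: "double_proper_splitting A P R S"
  shows "P * P\<^sup>\<dagger> = A * A\<^sup>\<dagger>" "P\<^sup>\<dagger> * P = A\<^sup>\<dagger> * A"
proof -
  have P: "P \<in> carrier_mat m n" and r: "range_space P = range_space A" and k: "null_space P = null_space A"
    using A sp by (auto simp: double_proper_splitting_def)
  note PA = mp_inverse_is_mp_inverse[of P] mp_inverse_is_mp_inverse[of A]
  show "P * P\<^sup>\<dagger> = A * A\<^sup>\<dagger>"
    using r A P by (intro mp_range_projection_eq[OF P A PA] range_space_subset_imp_projection) auto
  show "P\<^sup>\<dagger> * P = A\<^sup>\<dagger> * A"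
    using k A P by (intro mp_corange_projection_eq[OF P A PA] null_space_subset_imp_projection) auto
qed

text \<open>Collects the dimension and sign facts shared by the convergence and comparison proofs.
  The last claim holds because \<open>P\<^sup>\<dagger> U e\<close> contains the row sums of
  \<open>P\<^sup>\<dagger> R - P\<^sup>\<dagger> S\<close>, both summands being nonnegative; it
  supplies the support condition for companion matrices.\<close>

lemma double_proper_regular_splittingD:
  assumes A: "A \<in> carrier_mat m n" and sp: "double_proper_regular_splitting A P R S"
  defines "U \<equiv> R - S" and "e \<equiv> vec n (\<lambda>_. 1)"
  shows "P \<in> carrier_mat m n" "R \<in> carrier_mat m n" "S \<in> carrier_mat m n" "U \<in> carrier_mat m n"
    and "nonneg_mat (P\<^sup>\<dagger>)" "nonneg_mat R" "nonneg_mat (- S)" "nonneg_mat U"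
    and "nonneg_mat (P\<^sup>\<dagger> * R)" "nonneg_mat (- (P\<^sup>\<dagger> * S))"
    and "A = P - U" "U = P - A"
    and "0\<^sub>v m \<le> U *\<^sub>v e" "0\<^sub>v n \<le> P\<^sup>\<dagger> *\<^sub>v (U *\<^sub>v e)"
    and "\<And>i j. i < n \<Longrightarrow> j < n \<Longrightarrow> (P\<^sup>\<dagger> *\<^sub>v (U *\<^sub>v e)) $ i = 0 \<Longrightarrow>
           (P\<^sup>\<dagger> * R) $$ (i,j) = 0 \<and> (- (P\<^sup>\<dagger> * S)) $$ (i,j) = 0"
proof -
  show P: "P \<in> carrier_mat m n" and R: "R \<in> carrier_mat m n" and S: "S \<in> carrier_mat m n"
    and P0: "nonneg_mat (P\<^sup>\<dagger>)" and R0: "nonneg_mat R" and S0: "nonneg_mat (- S)"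
    using A sp by (auto simp: double_proper_regular_splitting_def double_proper_splitting_def
        nonpos_iff_nonneg_uminus)
  show U: "U \<in> carrier_mat m n" unfolding U_def using S by (rule minus_carrier_mat)
  show U0: "nonneg_mat U"
    using R0 S0 R S by (auto simp: U_def nonneg_mat_def intro: order_trans[of _ 0])
  have A_eq: "A = P - R + S"
    using sp by (auto simp: double_proper_regular_splitting_def double_proper_splitting_def)
  then show "A = P - U" "U = P - A"
    using P R S by (auto simp: U_def intro!: eq_matI)
  show B0: "nonneg_mat (P\<^sup>\<dagger> * R)" using P R P0 R0 by (intro nonneg_mat_mult) auto
  have "nonneg_mat (P\<^sup>\<dagger> * (- S))" using P S P0 S0 by (intro nonneg_mat_mult) auto
  then show C0: "nonneg_mat (- (P\<^sup>\<dagger> * S))" using P S by simp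
  have e0: "0\<^sub>v n \<le> e" by (auto simp: e_def less_eq_vec_def)
  show g0: "0\<^sub>v m \<le> U *\<^sub>v e" using U U0 e0 by (intro mult_mat_vec_nonneg) auto
  show "0\<^sub>v n \<le> P\<^sup>\<dagger> *\<^sub>v (U *\<^sub>v e)" by (rule mult_mat_vec_nonneg[OF P0 g0]) (use P in auto)
  fix i j assume ij: "i < n" "j < n" and z: "(P\<^sup>\<dagger> *\<^sub>v (U *\<^sub>v e)) $ i = 0"
  have "(P\<^sup>\<dagger> * U *\<^sub>v e) $ i = 0"
    using z P U by (simp add: mat_vec_assoc e_def)
  then have "(P\<^sup>\<dagger> * U) $$ (i,j) = 0"
    using P U P0 U0 ij unfolding e_def by (intro mult_ones_eq_0_imp_row_eq_0[of _ n n] nonneg_mat_mult) auto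
  moreover have "P\<^sup>\<dagger> * U = P\<^sup>\<dagger> * R - P\<^sup>\<dagger> * S" using P R S by (simp add: U_def mat_mult_diff)
  ultimately have "(P\<^sup>\<dagger> * R) $$ (i,j) + (- (P\<^sup>\<dagger> * S)) $$ (i,j) = 0"
    using P R S ij by (simp del: index_mult_mat(1))
  moreover have "(P\<^sup>\<dagger> * R) $$ (i,j) \<ge> 0" "(- (P\<^sup>\<dagger> * S)) $$ (i,j) \<ge> 0"
    using nonneg_mat_entry[OF B0, of i j] nonneg_mat_entry[OF C0, of i j] P R S ij
    by (simp_all del: index_mult_mat(1))
  ultimately show "(P\<^sup>\<dagger> * R) $$ (i,j) = 0 \<and> (- (P\<^sup>\<dagger> * S)) $$ (i,j) = 0" by linarith
qed

lemma double_proper_regular_splitting_convergent: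
  assumes A: "A \<in> carrier_mat m n" and n: "n > 0" and mono: "semi_monotone A"
    and sp: "double_proper_regular_splitting A P R S"
  shows "spectral_radius (cplx (iter_mat P R S)) < 1"
proof -
  define U where "U = R - S"
  define e :: "real vec" where "e = vec n (\<lambda>_. 1)"
  note F = double_proper_regular_splittingD[OF A sp, folded U_def e_def]
  define g where "g = U *\<^sub>v e"
  define p where "p = P\<^sup>\<dagger> *\<^sub>v g"
  define x where "x = A\<^sup>\<dagger> *\<^sub>v g"
  have g: "g \<in> carrier_vec m" "0\<^sub>v m \<le> g" and p: "p \<in> carrier_vec n" "0\<^sub>v n \<le> p"
    using F(1,4) F(13,14) by (auto simp: g_def p_def e_def)
  have x: "x \<in> carrier_vec n" "0\<^sub>v n \<le> x"
    using A g mono by (auto simp: x_def semi_monotone_def intro!: mult_mat_vec_nonneg)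
  have sp': "double_proper_splitting A P R S" using sp by (simp add: double_proper_regular_splitting_def)
  note proj = double_proper_splitting_projections[OF A sp']
  \<comment> \<open>Put \<open>U = P - A\<close>: equality of the projections turns
    \<open>P\<^sup>\<dagger> P A\<^sup>\<dagger>\<close> into \<open>A\<^sup>\<dagger>\<close> and
    \<open>P\<^sup>\<dagger> A A\<^sup>\<dagger>\<close> into
    \<open>P\<^sup>\<dagger>\<close>.\<close>
  have HA: "P\<^sup>\<dagger> * U * A\<^sup>\<dagger> = A\<^sup>\<dagger> - P\<^sup>\<dagger>"
  proof -
    have "P\<^sup>\<dagger> * U * A\<^sup>\<dagger> = P\<^sup>\<dagger> * P * A\<^sup>\<dagger> - P\<^sup>\<dagger> * (A * A\<^sup>\<dagger>)"
      unfolding F(12) using A F(1) by (simp add: mat_mult_diff mat_diff_mult mat_assoc)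
    also have "\<dots> = A\<^sup>\<dagger> - P\<^sup>\<dagger>"
      unfolding proj(1)[symmetric] unfolding proj(2) using mp_inverse_outer[of A] mp_inverse_outer[of P] F(1)
      by (simp add: mat_assoc)
    finally show ?thesis .
  qed
  have Hx: "P\<^sup>\<dagger> *\<^sub>v (U *\<^sub>v x) = x - p"
  proof -
    have "P\<^sup>\<dagger> *\<^sub>v (U *\<^sub>v x) = P\<^sup>\<dagger> * U * A\<^sup>\<dagger> *\<^sub>v g"
      using F(1,4) A g by (simp add: x_def mat_vec_assoc)
    also have "\<dots> = x - p"
      unfolding HA x_def p_def using F(1) A g by (intro minus_mult_distrib_mat_vec[of _ n m]) auto
    finally show ?thesis .
  qed
  have xi: "0 \<le> x $ i" and pi: "0 \<le> p $ i" if "i < n" for i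
    using that x p by (auto simp: less_eq_vec_def)
  \<comment> \<open>The sum of the entries bounds each entry, so \<open>x \<le> k e\<close>.
    Applying the nonnegative \<open>P\<^sup>\<dagger> U\<close> gives
    \<open>x - p \<le> k p\<close>, that is, \<open>p\<close> is at least a fixed fraction of
    \<open>x\<close>.\<close>
  define k where "k = (\<Sum>i<n. x $ i)"
  have k0: "0 \<le> k" using xi by (auto simp: k_def intro: sum_nonneg)
  have "x $ i \<le> k" if "i < n" for i
    unfolding k_def using that xi by (intro member_le_sum) auto
  then have "x \<le> k \<cdot>\<^sub>v e" using x by (auto simp: less_eq_vec_def e_def)
  then have "U *\<^sub>v x \<le> U *\<^sub>v (k \<cdot>\<^sub>v e)" using F(4,8) by (intro mult_mat_vec_mono) (auto simp: e_def)
  then have "U *\<^sub>v x \<le> k \<cdot>\<^sub>v g"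
    using F(4) by (simp add: g_def e_def mult_mat_vec[of _ m n])
  then have "P\<^sup>\<dagger> *\<^sub>v (U *\<^sub>v x) \<le> P\<^sup>\<dagger> *\<^sub>v (k \<cdot>\<^sub>v g)"
    using F(1,5) g by (intro mult_mat_vec_mono) auto
  then have "x - p \<le> k \<cdot>\<^sub>v p"
    using F(1) g by (simp add: Hx p_def mult_mat_vec[of _ n m])
  then have xp: "x $ i \<le> (1 + k) * p $ i" if "i < n" for i
    using that p x by (auto simp: less_eq_vec_def algebra_simps)
  \<comment> \<open>Chosen so that \<open>2 d x \<le> p\<close>. Then
    \<open>(B + C) x = x - p \<le> (1 - 2 d) x \<le> (1 - d)^2 x\<close>, which makes
    \<open>1 - d\<close> an admissible bound.\<close>
  define d where "d = 1 / (2 * (1 + k))"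
  have d: "0 < d" "d \<le> 1/2" using k0 by (auto simp: d_def field_simps)
  define B C where "B = P\<^sup>\<dagger> * R" and "C = - (P\<^sup>\<dagger> * S)"
  note B0 = F(9)[folded B_def] and C0 = F(10)[folded C_def]
  have supp: "B $$ (i,j) = 0 \<and> C $$ (i,j) = 0" if "i < n" "j < n" "p $ i = 0" for i j
    using F(15)[OF that(1,2)] that(3) by (simp only: B_def C_def p_def g_def)
  have BC: "B \<in> carrier_mat n n" "C \<in> carrier_mat n n" using F(1-3) by (auto simp: B_def C_def)
  have BCx: "(B *\<^sub>v x) $ i + (C *\<^sub>v x) $ i = x $ i - p $ i" if i: "i < n" for i
  proof -
    have "P\<^sup>\<dagger> * U = B + C" using F(1-3) by (simp add: U_def B_def C_def mat_mult_diff minus_add_uminus_mat[of _ n n])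
    then have "B *\<^sub>v x + C *\<^sub>v x = P\<^sup>\<dagger> * U *\<^sub>v x" using BC x by (simp add: add_mult_distrib_mat_vec[of _ n n])
    also have "\<dots> = x - p" using F(1,4) x Hx by (simp add: mat_vec_assoc)
    finally show ?thesis using i BC p x by (auto dest!: arg_cong[of _ _ "\<lambda>v. v $ i"] simp del: index_mult_mat_vec)
  qed
  have Bx: "0 \<le> (B *\<^sub>v x) $ i" and Cx: "0 \<le> (C *\<^sub>v x) $ i" if "i < n" for i
    using that nonneg_mult_mat_vec_entry[OF BC(1) B0 x(2)] nonneg_mult_mat_vec_entry[OF BC(2) C0 x(2)] by auto
  have "spectral_radius (cplx (iter_mat P R S)) \<le> 1 - d"
    unfolding iter_mat_def carrier_matD(2)[OF F(1)] B_def[symmetric] C_def[symmetric]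
  proof (rule companion_spectral_radius_le[OF BC(1) B0 BC(2) C0 n x(2)])
    fix i assume i: "i < n"
    have "2 * d * x $ i \<le> p $ i"
      using xp[OF i] k0 by (simp add: d_def field_simps)
    have "(1 - d) * (B *\<^sub>v x) $ i \<le> 1 * (B *\<^sub>v x) $ i"
      using Bx[OF i] d by (intro mult_right_mono) auto
    then have "(1 - d) * (B *\<^sub>v x) $ i + (C *\<^sub>v x) $ i \<le> (1 - 2 * d) * x $ i"
      using BCx[OF i] \<open>2 * d * x $ i \<le> p $ i\<close> by (simp add: left_diff_distrib)
    also have "\<dots> \<le> (1 - d)\<^sup>2 * x $ i"
      using xi[OF i] by (intro mult_right_mono) (auto simp: power2_eq_square algebra_simps)
    finally show "(1 - d) * (B *\<^sub>v x) $ i + (C *\<^sub>v x) $ i \<le> (1 - d)\<^sup>2 * x $ i" .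
    fix j assume j: "j < n" and "x $ i = 0"
    \<comment> \<open>From \<open>p = x - B x - C x\<close> a zero entry of \<open>x\<close> makes
      the nonnegative entry of \<open>p\<close> nonpositive as well.\<close>
    then have "p $ i = 0" using BCx[OF i] Bx[OF i] Cx[OF i] pi[OF i] by linarith
    then show "B $$ (i,j) = 0 \<and> C $$ (i,j) = 0"
      by (rule supp[OF i j])
  qed (use d in auto)
  then show ?thesis using d by simp
qed

section \<open>Comparison of the alternating iteration with the two single splittings\<close>

theorem theorem3p6:
  fixes A P1 R1 S1 P2 R2 S2 :: "real mat" and m n :: nat
  assumes "A \<in> carrier_mat m n" and "n > 0"
    and "semi_monotone A"
    and "double_proper_weak_regular_splitting A P1 R1 S1"
    and "double_proper_regular_splitting A P2 R2 S2"
    and "null_space P2 \<subseteq> null_space S2"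
    and "range_space S2 \<subseteq> range_space P2"
    and "1 \<notin> spectrum (cplx (S2 * P1\<^sup>\<dagger>))"
    and "nonneg_mat (((1\<^sub>m m - S2 * P1\<^sup>\<dagger>) * A)\<^sup>\<dagger>)"
    and "mat_ge (P1\<^sup>\<dagger> * R1) (P2\<^sup>\<dagger> * R2)"
    and "mat_ge (P2\<^sup>\<dagger> * S2) (P1\<^sup>\<dagger> * S1)"
  shows "spectral_radius (cplx (four_block_mat
            (P2\<^sup>\<dagger> * R2 - P2\<^sup>\<dagger> * S2 * P1\<^sup>\<dagger> * R1) (P2\<^sup>\<dagger> * S2 * P1\<^sup>\<dagger> * S1)
            (1\<^sub>m n) (0\<^sub>m n n)))
         \<le> min (spectral_radius (cplx (iter_mat P1 R1 S1))) (spectral_radius (cplx (iter_mat P2 R2 S2)))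
       \<and> min (spectral_radius (cplx (iter_mat P1 R1 S1))) (spectral_radius (cplx (iter_mat P2 R2 S2))) < 1"
proof -
  note A = assms(1) and n = assms(2)
  define U where "U = R2 - S2"
  define e :: "real vec" where "e = vec n (\<lambda>_. 1)"
  note F = double_proper_regular_splittingD[OF A assms(5), folded U_def e_def]
  define g where "g = U *\<^sub>v e"
  define p where "p = P2\<^sup>\<dagger> *\<^sub>v g"
  have g: "g \<in> carrier_vec m" "0\<^sub>v m \<le> g" and p: "p \<in> carrier_vec n" "0\<^sub>v n \<le> p"
    using F(1,4) F(13,14) by (auto simp: g_def p_def e_def)
  have sp1: "double_proper_splitting A P1 R1 S1" and P10: "nonneg_mat (P1\<^sup>\<dagger>)"
    using assms(4) by (auto simp: double_proper_weak_regular_splitting_def nonpos_iff_nonneg_uminus)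
  have c1: "P1 \<in> carrier_mat m n" "R1 \<in> carrier_mat m n" "S1 \<in> carrier_mat m n" and A1: "A = P1 - R1 + S1"
    using sp1 A by (auto simp: double_proper_splitting_def)
  have sp2: "double_proper_splitting A P2 R2 S2"
    using assms(5) by (simp add: double_proper_regular_splitting_def)
  note proj1 = double_proper_splitting_projections[OF A sp1]
  note proj2 = double_proper_splitting_projections[OF A sp2]
  define B1 C1 B2 C2 where B1_def: "B1 = P1\<^sup>\<dagger> * R1" and C1_def: "C1 = - (P1\<^sup>\<dagger> * S1)"
    and B2_def: "B2 = P2\<^sup>\<dagger> * R2" and C2_def: "C2 = - (P2\<^sup>\<dagger> * S2)"
  note BC_def = B1_def C1_def B2_def C2_def
  have B10: "nonneg_mat B1" and C10: "nonneg_mat C1"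
    using assms(4) by (auto simp: BC_def double_proper_weak_regular_splitting_def nonpos_iff_nonneg_uminus)
  note B20 = F(9)[folded B2_def] and C20 = F(10)[folded C2_def]
  have supp: "B2 $$ (i,j) = 0 \<and> C2 $$ (i,j) = 0" if "i < n" "j < n" "p $ i = 0" for i j
    using F(15)[OF that(1,2)] that(3) by (simp only: B2_def C2_def p_def g_def)
  have BC: "B1 \<in> carrier_mat n n" "C1 \<in> carrier_mat n n" "B2 \<in> carrier_mat n n" "C2 \<in> carrier_mat n n"
    using F(1-3) c1 by (auto simp: BC_def)
  \<comment> \<open>The upper blocks of the alternating iteration matrix. The signs in
    \<open>C1\<close> and \<open>C2\<close> cancel in \<open>Y\<close>, and the one in
    \<open>C2\<close> absorbs the minus sign in \<open>X\<close>, so nonnegativity becomes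
    visible.\<close>
  define X Y where "X = B2 + C2 * B1" and "Y = C2 * C1"
  have XY: "X \<in> carrier_mat n n" "Y \<in> carrier_mat n n" using BC by (auto simp: X_def Y_def)
  have CB: "C2 * B1 = - (P2\<^sup>\<dagger> * S2 * P1\<^sup>\<dagger> * R1)"
    using F(1-3) c1 by (simp add: BC_def mat_assoc)
  have X_eq: "P2\<^sup>\<dagger> * R2 - P2\<^sup>\<dagger> * S2 * P1\<^sup>\<dagger> * R1 = X"
    unfolding X_def CB B2_def using F(1-3) c1 by (intro minus_add_uminus_mat[of _ n n]) auto
  have Y_eq: "P2\<^sup>\<dagger> * S2 * P1\<^sup>\<dagger> * S1 = Y"
    using F(1-3) c1 by (simp add: Y_def BC_def mat_assoc)
  have CB0: "nonneg_mat (C2 * B1)" and Y0: "nonneg_mat Y"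
    unfolding Y_def using C20 B10 C10 BC by (auto intro!: nonneg_mat_mult)
  then have X0: "nonneg_mat X" using B20 BC unfolding X_def by (auto simp: nonneg_mat_def)
  let ?r1 = "spectral_radius (cplx (iter_mat P1 R1 S1))" and ?r2 = "spectral_radius (cplx (iter_mat P2 R2 S2))"
  let ?W = "four_block_mat X Y (1\<^sub>m n) (0\<^sub>m n n)"
  have r2: "?r2 < 1" by (rule double_proper_regular_splitting_convergent[OF A n assms(3,5)])
  have r12: "?r2 \<le> ?r1"
  proof (rule spectral_radius_mono[of _ "n + n"])
    have d: "iter_mat P1 R1 S1 = four_block_mat B1 C1 (1\<^sub>m n) (0\<^sub>m n n)"
        "iter_mat P2 R2 S2 = four_block_mat B2 C2 (1\<^sub>m n) (0\<^sub>m n n)"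
      using c1 F(1) by (auto simp: iter_mat_def BC_def)
    have ge: "mat_ge B1 B2" "mat_ge C1 C2"
      using assms(10,11) by (auto simp: mat_ge_def BC_def simp del: index_mult_mat(1))
    show "iter_mat P2 R2 S2 \<in> carrier_mat (n + n) (n + n)" "iter_mat P1 R1 S1 \<in> carrier_mat (n + n) (n + n)"
      using BC by (auto simp: d)
    show "nonneg_mat (iter_mat P2 R2 S2)"
      using BC B20 C20 by (auto simp: d nonneg_mat_def)
    show "mat_ge (iter_mat P1 R1 S1) (iter_mat P2 R2 S2)"
      using BC ge by (auto simp: d mat_ge_def)
  qed (use n in auto)
  \<comment> \<open>The bound is shown for every \<open>s\<close> strictly between
    \<open>?r2\<close> and 1: the lower limit makes the resolvent vector available, and the upper
    one yields \<open>A x \<ge> 0\<close> and \<open>v \<le> x\<close>.\<close>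
  have rW: "spectral_radius (cplx ?W) \<le> s" if s: "?r2 < s" "s < 1" for s
  proof -
    have "0 \<le> ?r2" using F(1-3) n by (intro spectral_radius_nonneg[of _ "n + n"]) (auto simp: iter_mat_def)
    then have s0: "s > 0" using s by simp
    obtain x where x0: "0\<^sub>v n \<le> x" and x_eq: "s\<^sup>2 \<cdot>\<^sub>v x = s \<cdot>\<^sub>v (B2 *\<^sub>v x) + C2 *\<^sub>v x + p"
      using companion_resolvent[OF BC(3) B20 BC(4) C20 _ p(2), of s] s
      unfolding iter_mat_def carrier_matD(2)[OF F(1)] BC_def[symmetric] by blast
    have x: "x \<in> carrier_vec n" using x0 by (auto simp: less_eq_vec_def)
    define a d where "a = R2 *\<^sub>v x" and "d = (- S2) *\<^sub>v x"
    have ad: "a \<in> carrier_vec m" "d \<in> carrier_vec m" using F(1-3) x by (auto simp: a_def d_def)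
    have a0: "0\<^sub>v m \<le> a" and d0: "0\<^sub>v m \<le> d"
      using F(1-3,6,7) x0 unfolding a_def d_def by (auto intro!: mult_mat_vec_nonneg)
    have Cd: "C2 *\<^sub>v x = P2\<^sup>\<dagger> *\<^sub>v d"
    proof -
      have "C2 = P2\<^sup>\<dagger> * (- S2)" using F(1,3) by (simp add: C2_def)
      then show ?thesis using F(1,3) x by (simp only: d_def) (intro mat_vec_assoc, auto)
    qed
    have Ba: "B2 *\<^sub>v x = P2\<^sup>\<dagger> *\<^sub>v a" using F(1,2) x by (simp add: a_def B2_def mat_vec_assoc)
    have lin: "M *\<^sub>v (s \<cdot>\<^sub>v a + d + g) = s \<cdot>\<^sub>v (M *\<^sub>v a) + M *\<^sub>v d + M *\<^sub>v g"
      if "M \<in> carrier_mat k m" for M k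
    proof -
      have "M *\<^sub>v (s \<cdot>\<^sub>v a + d + g) = M *\<^sub>v (s \<cdot>\<^sub>v a + d) + M *\<^sub>v g"
        using that ad g by (intro mult_add_distrib_mat_vec) auto
      also have "M *\<^sub>v (s \<cdot>\<^sub>v a + d) = M *\<^sub>v (s \<cdot>\<^sub>v a) + M *\<^sub>v d"
        using that ad by (intro mult_add_distrib_mat_vec) auto
      also have "M *\<^sub>v (s \<cdot>\<^sub>v a) = s \<cdot>\<^sub>v (M *\<^sub>v a)"
        using that ad by (intro mult_mat_vec) auto
      finally show ?thesis .
    qed
    have x_P: "s\<^sup>2 \<cdot>\<^sub>v x = P2\<^sup>\<dagger> *\<^sub>v (s \<cdot>\<^sub>v a + d + g)"
      unfolding x_eq Cd Ba p_def using F(1) by (intro lin[symmetric]) simp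
    \<comment> \<open>By its equation \<open>x\<close> lies in the range of
      \<open>P2\<^sup>\<dagger>\<close>, on which \<open>P2\<^sup>\<dagger> P2\<close> is the
      identity. This projection equals \<open>P1\<^sup>\<dagger> P1\<close>, since both coincide
      with \<open>A\<^sup>\<dagger> A\<close>.\<close>
    have Qx: "P1\<^sup>\<dagger> * P1 *\<^sub>v x = x"
    proof -
      have "P2\<^sup>\<dagger> * P2 *\<^sub>v (s\<^sup>2 \<cdot>\<^sub>v x) = P2\<^sup>\<dagger> * P2 * P2\<^sup>\<dagger> *\<^sub>v (s \<cdot>\<^sub>v a + d + g)"
        unfolding x_P using F(1) ad g by (simp add: mat_vec_assoc)
      also have "\<dots> = s\<^sup>2 \<cdot>\<^sub>v x" unfolding mp_inverse_outer x_P ..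
      finally have "s\<^sup>2 \<cdot>\<^sub>v (P2\<^sup>\<dagger> * P2 *\<^sub>v x) = s\<^sup>2 \<cdot>\<^sub>v x" using F(1) x by (simp add: mult_mat_vec[of _ n n])
      then have "(1 / s\<^sup>2) \<cdot>\<^sub>v (s\<^sup>2 \<cdot>\<^sub>v (P2\<^sup>\<dagger> * P2 *\<^sub>v x)) = (1 / s\<^sup>2) \<cdot>\<^sub>v (s\<^sup>2 \<cdot>\<^sub>v x)" by simp
      then show ?thesis using s0 unfolding proj1 proj2 by (simp add: smult_smult_assoc)
    qed
    \<comment> \<open>These matrices have their columns in the range of \<open>P2\<close>:
      \<open>S2\<close> by hypothesis, \<open>U = P2 - A\<close> because \<open>A\<close> and
      \<open>P2\<close> share their range, and \<open>R2 = U + S2\<close>. Multiplying the equation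
      for \<open>x\<close> by \<open>P2\<close> therefore removes
      \<open>P2\<^sup>\<dagger>\<close>.\<close>
    have PPU: "P2 * P2\<^sup>\<dagger> * M = M" if "M = R2 \<or> M = - S2 \<or> M = U" for M
    proof -
      have PA: "P2 * P2\<^sup>\<dagger> * A = A"
        using sp2 F(1) A by (intro range_space_subset_imp_projection) (auto simp: double_proper_splitting_def)
      have PP: "P2 * P2\<^sup>\<dagger> * P2 = P2" using F(1) by (intro range_space_subset_imp_projection) auto
      have PS: "P2 * P2\<^sup>\<dagger> * S2 = S2" using F(1,3) assms(7) by (intro range_space_subset_imp_projection) auto
      have PS': "P2 * P2\<^sup>\<dagger> * (- S2) = - S2"
        using PS F(1,3) by simp
      have PU: "P2 * P2\<^sup>\<dagger> * U = U"
        unfolding F(12) using A F(1) PA PP mat_mult_diff[of P2 A "P2 * P2\<^sup>\<dagger>"] by simp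
      have "R2 = U + S2" using F(2,3) by (intro eq_matI) (auto simp: U_def)
      then have "P2 * P2\<^sup>\<dagger> * R2 = R2"
        using F(1,3,4) PU PS mult_add_distrib_mat[of "P2 * P2\<^sup>\<dagger>" m m U n S2] by simp
      then show ?thesis using that PS' PU by blast
    qed
    have PPv: "P2 * P2\<^sup>\<dagger> *\<^sub>v (M *\<^sub>v v) = M *\<^sub>v v" 
      if "M = R2 \<or> M = - S2 \<or> M = U" "v \<in> carrier_vec n" for M v
    proof -
      have "M \<in> carrier_mat m n" using that F(2-4) by auto
      then have "P2 * P2\<^sup>\<dagger> *\<^sub>v (M *\<^sub>v v) = P2 * P2\<^sup>\<dagger> * M *\<^sub>v v"
        using F(1) that(2) by (intro assoc_mult_mat_vec[symmetric, of _ m m _ n]) auto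
      then show ?thesis using PPU[OF that(1)] by simp
    qed
    have Px_eq: "s\<^sup>2 \<cdot>\<^sub>v (P2 *\<^sub>v x) = s \<cdot>\<^sub>v a + d + g"
    proof -
      have "s\<^sup>2 \<cdot>\<^sub>v (P2 *\<^sub>v x) = P2 *\<^sub>v (s\<^sup>2 \<cdot>\<^sub>v x)" using F(1) x by (simp add: mult_mat_vec[of _ m n])
      also have "\<dots> = P2 * P2\<^sup>\<dagger> *\<^sub>v (s \<cdot>\<^sub>v a + d + g)"
        unfolding x_P using F(1) ad g by (intro mat_vec_assoc[symmetric]) auto
      also have "\<dots> = s \<cdot>\<^sub>v (P2 * P2\<^sup>\<dagger> *\<^sub>v a) + P2 * P2\<^sup>\<dagger> *\<^sub>v d + P2 * P2\<^sup>\<dagger> *\<^sub>v g"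
        using F(1) by (intro lin) auto
      also have "\<dots> = s \<cdot>\<^sub>v a + d + g"
        using PPv[of R2 x] PPv[of "- S2" x] PPv[of U e] x by (simp add: a_def d_def g_def e_def)
      finally show ?thesis .
    qed
    have Ax: "0\<^sub>v m \<le> A *\<^sub>v x"
    proof -
      have "0 \<le> (A *\<^sub>v x) $ i" if i: "i < m" for i
      proof -
        define b where "b = (P2 *\<^sub>v x) $ i"
        have "U *\<^sub>v x = a + d"
        proof -
          have "U = R2 + (- S2)" using F(2,3) by (simp add: U_def minus_add_uminus_mat[of _ m n])
          then show ?thesis using F(2,3) x by (simp add: a_def d_def add_mult_distrib_mat_vec[of _ m n])
        qed
        moreover have "A *\<^sub>v x = P2 *\<^sub>v x - U *\<^sub>v x"
          unfolding F(11) using F(1,4) x by (intro minus_mult_distrib_mat_vec) auto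
        ultimately have Axi: "(A *\<^sub>v x) $ i = b - a $ i - d $ i"
          using i F(1) ad by (simp add: b_def)
        have nn: "0 \<le> a $ i" "0 \<le> d $ i" "0 \<le> g $ i"
          using i a0 d0 g by (auto simp: less_eq_vec_def)
        have eq: "s\<^sup>2 * b = s * a $ i + d $ i + g $ i"
          using arg_cong[OF Px_eq, of "\<lambda>v. v $ i"] i F(1) ad g by (simp add: b_def del: index_mult_mat_vec)
        then have "s * (s * b - a $ i) \<ge> 0" using nn by (simp add: power2_eq_square algebra_simps)
        then have sb: "a $ i \<le> s * b" using s0 by (simp add: zero_le_mult_iff)
        then have "0 \<le> b" using nn s0 by (meson order_trans zero_le_mult_iff not_less)
        \<comment> \<open>Eliminating \<open>d\<close> through \<open>s^2 b = s a + d + g\<close>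
          shows that \<open>(1 - s) (b + (s b - a))\<close> equals \<open>b - a - d - g\<close>, so
          it lies below the entry of \<open>A x\<close>.\<close>
        then have "0 \<le> (1 - s) * (b + (s * b - a $ i))" using s sb by simp
        also have "\<dots> \<le> b - a $ i - d $ i"
          using eq nn by (simp add: power2_eq_square algebra_simps)
        finally show ?thesis unfolding Axi .
      qed
      then show ?thesis using A by (auto simp: less_eq_vec_def)
    qed
    \<comment> \<open>\<open>v\<close> is what replaces \<open>x\<close> under \<open>C2\<close>. It
      lies below \<open>x\<close> since \<open>P1\<^sup>\<dagger> A x \<ge> 0\<close> means
      \<open>B1 x + C1 x \<le> x\<close>, and the factor \<open>s < 1\<close> only decreases
      \<open>B1 x\<close>.\<close>
    define v where "v = s \<cdot>\<^sub>v (B1 *\<^sub>v x) + C1 *\<^sub>v x"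
    have v: "v \<in> carrier_vec n" using BC x by (simp add: v_def)
    have vx: "v \<le> x"
    proof -
      have "0\<^sub>v n \<le> P1\<^sup>\<dagger> *\<^sub>v (A *\<^sub>v x)" by (rule mult_mat_vec_nonneg[OF P10 Ax]) (use c1 in auto)
      moreover have "P1\<^sup>\<dagger> *\<^sub>v (A *\<^sub>v x) = x - B1 *\<^sub>v x - C1 *\<^sub>v x"
      proof -
        have "P1\<^sup>\<dagger> * A = P1\<^sup>\<dagger> * P1 - B1 - C1"
          unfolding A1 BC_def using c1 by (subst mult_add_distrib_mat[of _ n m]) (auto simp: mat_mult_diff intro!: eq_matI)
        then have "P1\<^sup>\<dagger> *\<^sub>v (A *\<^sub>v x) = (P1\<^sup>\<dagger> * P1 - B1 - C1) *\<^sub>v x"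
          using c1 A x by (simp flip: mat_vec_assoc)
        also have "\<dots> = P1\<^sup>\<dagger> * P1 *\<^sub>v x - B1 *\<^sub>v x - C1 *\<^sub>v x"
          using c1 BC x by (simp add: mat_diff_vec)
        finally show ?thesis unfolding Qx .
      qed
      ultimately have i1: "(B1 *\<^sub>v x) $ i + (C1 *\<^sub>v x) $ i \<le> x $ i" if "i < n" for i
        using that x BC by (auto simp: less_eq_vec_def simp del: index_mult_mat_vec)
      have "0\<^sub>v n \<le> B1 *\<^sub>v x" using BC B10 x0 by (intro mult_mat_vec_nonneg) auto
      then have "s * (B1 *\<^sub>v x) $ i \<le> (B1 *\<^sub>v x) $ i" if "i < n" for i
        using that s s0 by (intro mult_left_le_one_le) (auto simp: less_eq_vec_def)
      then have "v $ i \<le> x $ i" if "i < n" for i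
        using i1[OF that] that BC x by (fastforce simp: v_def simp del: index_mult_mat_vec)
      then show ?thesis using v x by (auto simp: less_eq_vec_def)
    qed
    have C2v: "C2 *\<^sub>v v \<le> C2 *\<^sub>v x" using BC C20 vx x by (intro mult_mat_vec_mono) auto
    have xe: "s * (B2 *\<^sub>v x) $ i + (C2 *\<^sub>v x) $ i + p $ i = s\<^sup>2 * x $ i" if "i < n" for i
      using arg_cong[OF x_eq, of "\<lambda>v. v $ i"] that BC x p by (simp del: index_mult_mat_vec)
    \<comment> \<open>Expanding \<open>X\<close> and \<open>Y\<close> collects the terms with
      \<open>C2\<close> into \<open>C2 v\<close>, so replacing \<open>v\<close> by \<open>x\<close>
      leads back to the equation defining \<open>x\<close>.\<close>
    have XYx: "s \<cdot>\<^sub>v (X *\<^sub>v x) + Y *\<^sub>v x = s \<cdot>\<^sub>v (B2 *\<^sub>v x) + C2 *\<^sub>v v"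
    proof -
      have "X *\<^sub>v x = B2 *\<^sub>v x + C2 *\<^sub>v (B1 *\<^sub>v x)"
        unfolding X_def using BC x by (subst add_mult_distrib_mat_vec[of _ n n]) (auto simp: mat_vec_assoc)
      moreover have "Y *\<^sub>v x = C2 *\<^sub>v (C1 *\<^sub>v x)"
        unfolding Y_def using BC x by (intro mat_vec_assoc) auto
      moreover have "C2 *\<^sub>v v = s \<cdot>\<^sub>v (C2 *\<^sub>v (B1 *\<^sub>v x)) + C2 *\<^sub>v (C1 *\<^sub>v x)"
        unfolding v_def using BC x
        by (subst mult_add_distrib_mat_vec[of _ n n]) (auto simp: mult_mat_vec[of _ n n])
      ultimately show ?thesis using BC x
        by (intro eq_vecI) (auto simp: distrib_left simp del: index_mult_mat_vec)
    qed
    show ?thesis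
    proof (rule companion_spectral_radius_le[OF XY(1) X0 XY(2) Y0 n x0 s0])
      fix i assume i: "i < n"
      have "s * (X *\<^sub>v x) $ i + (Y *\<^sub>v x) $ i = s * (B2 *\<^sub>v x) $ i + (C2 *\<^sub>v v) $ i"
        using arg_cong[OF XYx, of "\<lambda>v. v $ i"] i BC XY by (simp del: index_mult_mat_vec)
      also have "\<dots> \<le> s * (B2 *\<^sub>v x) $ i + (C2 *\<^sub>v x) $ i"
        using C2v i BC by (auto simp: less_eq_vec_def simp del: index_mult_mat_vec)
      also have "\<dots> \<le> s\<^sup>2 * x $ i" using xe[OF i] p i by (auto simp: less_eq_vec_def)
      finally show "s * (X *\<^sub>v x) $ i + (Y *\<^sub>v x) $ i \<le> s\<^sup>2 * x $ i" .
      \<comment> \<open>A zero entry of \<open>x\<close> forces the corresponding entry of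
        \<open>p\<close> to vanish, hence the rows of \<open>B2\<close> and \<open>C2\<close>. The
        rows of \<open>X = B2 + C2 B1\<close> and \<open>Y = C2 C1\<close> then vanish too.\<close>
      fix j assume j: "j < n" and xi: "x $ i = 0"
      have "0 \<le> (B2 *\<^sub>v x) $ i" "0 \<le> (C2 *\<^sub>v x) $ i"
        using nonneg_mult_mat_vec_entry[OF BC(3) B20 x0 i] nonneg_mult_mat_vec_entry[OF BC(4) C20 x0 i] by auto
      moreover have "0 \<le> p $ i" using p i by (auto simp: less_eq_vec_def)
      moreover have "0 \<le> s * (B2 *\<^sub>v x) $ i" using calculation(1) s0 by simp
      ultimately have "p $ i = 0" using xe[OF i] xi by simp
      then have z: "B2 $$ (i,l) = 0" "C2 $$ (i,l) = 0" if "l < n" for l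
        using supp[OF i that] by blast+
      then have "row C2 i = 0\<^sub>v n" using i BC by (intro eq_vecI) auto
      then have "(C2 * M) $$ (i,j) = 0" if "M \<in> carrier_mat n n" for M
        using that i j BC by simp
      then show "X $$ (i,j) = 0 \<and> Y $$ (i,j) = 0"
        using z(1)[OF j] i j BC unfolding X_def Y_def by (simp del: index_mult_mat(1))
    qed
  qed
  \<comment> \<open>Let \<open>s\<close> decrease to \<open>?r2\<close>.\<close>
  have "spectral_radius (cplx ?W) \<le> ?r2"
    using rW by (intro dense_ge_bounded[OF r2]) auto
  then show ?thesis using r2 r12 unfolding X_eq Y_eq by simp
qed

end
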